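(* Consider a Nash equilibrium problem of polynomials with $N$ players, objectives $f_i\in\mathbb{R}[x]$ and constraining polynomial tuples $g_i=(g_{i,1},\ldots,g_{i,m_i})$, $g_{i,j}\in\mathbb{R}[x_i]$ (see context). Assume each $g_i$ is nonsingular, with polynomial expressions of Lagrange multipliers $\lambda_{i,j}(x)$ as in the context. Let $\mathcal{G}$ be the set of all $x\in\mathbb{R}^n$ satisfying the KKT system (K), let $\mathcal{G}^*$ be the set of all Nash equilibria, and assume $\mathcal{G}\setminus\mathcal{G}^*$ is a finite set. Let $\Theta$ be a generic positive definite matrix and let $x^*$ be a Nash equilibrium computed by Algorithm A with this $\Theta$. If $x^*$ is an isolated KKT point (an isolated point of $\mathcal{G}$), then Algorithm B of the context, applied to $x^*$, terminates after finitely many steps, either returning a Nash equilibrium that is different from $x^*$ or reporting the nonexistence of other Nash equilibria.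
   Context: **Nash equilibrium problem (NEP) of polynomials.** There are $N$ players; player $i$ has strategy $x_i\in\mathbb{R}^{n_i}$; $x=(x_1,\ldots,x_N)\in\mathbb{R}^n$, $n=n_1+\cdots+n_N$; $x_{-i}$ is the vector of all blocks except $x_i$, and one writes $x=(x_i,x_{-i})$. $[N]=\{1,\ldots,N\}$. Player $i$ has an objective $f_i\in\mathbb{R}[x]$ and constraining polynomials $g_{i,j}\in\mathbb{R}[x_i]$, $j\in[m_i]=\mathcal{E}_i\sqcup\mathcal{I}_i$, with feasible set $X_i=\{x_i\in\mathbb{R}^{n_i}: g_{i,j}(x_i)=0\ (j\in\mathcal{E}_i),\ g_{i,j}(x_i)\ge0\ (j\in\mathcal{I}_i)\}$. A Nash equilibrium (NE) is a point $x^*$ such that for every $i$, $x_i^*$ is a (global) minimizer of $f_i(\cdot,x_{-i}^* )$ over $X_i$. **Nonsingularity and multiplier expressions.** Let $G_i(x_i)$ be the $(n_i+m_i)\times m_i$ matrix polynomial whose top $n_i$ rows are $[\nabla_{x_i}g_{i,1}(x_i)\ \cdots\ \nabla_{x_i}g_{i,m_i}(x_i)]$ and whose bottom $m_i$ rows are $\mathrm{diag}(g_{i,1}(x_i),\ldots,g_{i,m_i}(x_i))$. The tuple $g_i$ is nonsingular if $G_i(x_i)$ has full column rank for every $x_i\in\mathbb{C}^{n_i}$. In that case there is a matrix polynomial $H_i(x_i)$ with real coefficients such that $H_i(x_i)G_i(x_i)=I_{m_i}$; fix one. Let $\hat f_i(x)=(\nabla_{x_i}f_i(x),0,\ldots,0)\in\mathbb{R}^{n_i+m_i}$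 and $\lambda_{i,j}(x):=(H_i(x_i)\hat f_i(x))_j$. **System (K).** For all $i\in[N]$: $\nabla_{x_i}f_i(x)-\sum_{j=1}^{m_i}\lambda_{i,j}(x)\nabla_{x_i}g_{i,j}(x_i)=0$; $g_{i,j}(x_i)=0$ for $j\in\mathcal{E}_i$; and $\lambda_{i,j}(x)g_{i,j}(x_i)=0$, $g_{i,j}(x_i)\ge0$, $\lambda_{i,j}(x)\ge0$ for $j\in\mathcal{I}_i$. Solutions $x\in\mathbb{R}^n$ are exactly the KKT points of the NEP. **Problem (U).** For finite sets $\mathcal{K}_i\subseteq X_i$, a symmetric positive definite $\Theta\in\mathbb{R}^{(n+1)\times(n+1)}$ and $[x]_1:=(1,x^T)^T\in\mathbb{R}^{n+1}$: minimize $[x]_1^T\Theta[x]_1$ over all $x\in\mathbb{R}^n$ satisfying (K) and $f_i(v,x_{-i})-f_i(x_i,x_{-i})\ge0$ for all $v\in\mathcal{K}_i$, $i\in[N]$. **Problem (U$_\delta$).** Minimize $[x]_1^T\Theta[x]_1$ over all $x$ feasible for (U) with $[x]_1^T\Theta[x]_1\ge[x^*]_1^T\Theta[x^*]_1+\delta$. **Problem (M$_\delta$).** Maximize $[x]_1^T\Theta[x]_1$ over all $x$ feasible for (U) with $[x]_1^T\Theta[x]_1\le[x^*]_1^T\Theta[x^*]_1+\delta$. **Problem (L$_i(u)$).** For $u\in\mathbb{R}^n$: $\omega_i:=\min\{f_i(x_i,u_{-i})-f_i(u_i,u_{-i}): x_i\in X_i\}$. In both algorithms all optimization problems are solved exactly,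 and it is understood that each problem (L$_i(u)$) that is encountered has a minimizer. **Algorithm A.** Step 0: set $\mathcal{K}_i:=\emptyset$ for all $i$; choose a generic positive definite $\Theta$ of size $n+1$. Step 1: solve (U). If it is infeasible, output that there is no NE and stop; otherwise let $u$ be an optimizer. Step 2: solve (L$_i(u)$) for each $i$. If all $\omega_i\ge0$, output the NE $u$ and stop; otherwise go to Step 3. Step 3: for each $i$ with $\omega_i<0$, obtain a nonempty finite set $U_i$ of some (not necessarily all) optimizers of (L$_i(u)$), replace $\mathcal{K}_i$ by $\mathcal{K}_i\cup U_i$, and go to Step 1. **Algorithm B** (input: a computed NE $x^*$, with the $\Theta$ and the sets $\mathcal{K}_i$ from its computation). Step 0: give an initial value $\delta>0$ (say $0.1$). Step 1: solve (M$_\delta$). If its optimal value $\eta$ equals $\upsilon:=[x^*]_1^T\Theta[x^*]_1$, go to Step 2. If $\eta>\upsilon$, replace $\delta$ by $\delta/5$ and repeat this step. Step 2: solve (U$_\delta$). If it is infeasible, output that there are no additional NEs and stop; otherwise let $u$ be a minimizer. Step 3: solve (L$_i(u)$) for each $i$. If all $\omega_i\ge0$, output the new NE $u$ and stop; otherwise go to Step 4. Step 4: for each $i$ with $\omega_i<0$, obtain a nonempty finite set $U_i$ of optimizers of (L$_i(u)$), replace $\mathcal{K}_i$ by $\mathcal{K}_i\cup U_i$, and go to Step 2. **Generic $\Theta$**: the assertion holds for all symmetric positive definite $\Theta$ outside a set of Lebesgue measure zero (depending on the NEP). *)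

theory Defs
  imports "HOL-Analysis.Analysis" "HOL-Library.Poly_Mapping"
begin

text \<open>
  A monomial is a finitely supported exponent vector, a polynomial a finitely supported family of
  real coefficients indexed by monomials; the ring operations are those of
  \<^theory>\<open>HOL-Library.Poly_Mapping\<close>.
\<close>

type_synonym 'n mpoly = "('n \<Rightarrow>\<^sub>0 nat) \<Rightarrow>\<^sub>0 real"

text \<open>Evaluation is polymorphic, so that real polynomials can be evaluated at complex points.\<close>

definition mp_eval :: "'a::real_field ^ 'n::finite \<Rightarrow> 'n mpoly \<Rightarrow> 'a" where
  "mp_eval x p = (\<Sum>m\<in>Poly_Mapping.keys p.
     of_real (Poly_Mapping.lookup p m) * (\<Prod>k\<in>UNIV. (x $ k) ^ Poly_Mapping.lookup m k))"

text \<open>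
  The formal partial derivative. Subtraction of exponents is truncated, but a monomial not
  containing the variable \<open>k\<close> gets the coefficient 0.
\<close>

definition mp_diff :: "'n \<Rightarrow> 'n mpoly \<Rightarrow> 'n mpoly" where
  "mp_diff k p = (\<Sum>m\<in>Poly_Mapping.keys p.
     Poly_Mapping.single (m - Poly_Mapping.single k 1)
       (of_nat (Poly_Mapping.lookup m k) * Poly_Mapping.lookup p m))"

definition mp_vars :: "'n mpoly \<Rightarrow> 'n set" where
  "mp_vars p = (\<Union>m\<in>Poly_Mapping.keys p. Poly_Mapping.keys m)"

text \<open>
  The players are the elements of the finite type \<open>'p\<close>, the coordinates of the joint strategy
  vector those of \<open>'n\<close>, and \<^term>\<open>owner P k\<close> is the player controlling coordinate \<open>k\<close>. So player
  \<open>i\<close> has \<open>n\<^sub>i = card {k. owner P k = i}\<close> coordinates. The constraints of player \<open>i\<close> are indexed by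
  the disjoint subsets \<^term>\<open>eqs P i\<close> and \<^term>\<open>ineqs P i\<close> of the finite type \<open>'j\<close>, which only has
  to be large enough; in particular \<open>m\<^sub>i = card (eqs P i \<union> ineqs P i)\<close> may vary with \<open>i\<close> and may
  be 0.
\<close>

record ('p, 'n, 'j) nep =
  owner :: "'n \<Rightarrow> 'p"
  obj :: "'p \<Rightarrow> 'n mpoly"
  con :: "'p \<Rightarrow> 'j \<Rightarrow> 'n mpoly"
  eqs :: "'p \<Rightarrow> 'j set"
  ineqs :: "'p \<Rightarrow> 'j set"

definition cons :: "('p, 'n, 'j) nep \<Rightarrow> 'p \<Rightarrow> 'j set" where
  "cons P i = eqs P i \<union> ineqs P i"

definition coords :: "('p, 'n, 'j) nep \<Rightarrow> 'p \<Rightarrow> 'n set" where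
  "coords P i = {k. owner P k = i}"

definition nep :: "('p, 'n, 'j) nep \<Rightarrow> bool" where
  "nep P \<longleftrightarrow> (\<forall>i. eqs P i \<inter> ineqs P i = {} \<and>
     (\<forall>j\<in>cons P i. mp_vars (con P i j) \<subseteq> coords P i))"

text \<open>
  The space of strategies of player \<open>i\<close> (\<open>\<real>\<^sup>n\<close> or \<open>\<complex>\<^sup>n\<close> with \<open>n = n\<^sub>i\<close>) is represented
  by the coordinate subspace of the joint vectors vanishing outside the coordinates of \<open>i\<close>.
\<close>

definition block :: "('p, 'n, 'j) nep \<Rightarrow> 'p \<Rightarrow> ('a::zero ^ 'n) set" where
  "block P i = {v. \<forall>k. k \<notin> coords P i \<longrightarrow> v $ k = 0}"

definition strat :: "('p, 'n, 'j) nep \<Rightarrow> 'p \<Rightarrow> 'a::zero ^ 'n \<Rightarrow> 'a ^ 'n" where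
  "strat P i x = (\<chi> k. if k \<in> coords P i then x $ k else 0)"

text \<open>The vector \<open>(v, x\<^sub>-\<^sub>i)\<close>.\<close>

definition replace :: "('p, 'n, 'j) nep \<Rightarrow> 'p \<Rightarrow> 'a ^ 'n \<Rightarrow> 'a ^ 'n \<Rightarrow> 'a ^ 'n" where
  "replace P i v x = (\<chi> k. if k \<in> coords P i then v $ k else x $ k)"

definition feas :: "('p, 'n::finite, 'j) nep \<Rightarrow> 'p \<Rightarrow> (real ^ 'n) set" where
  "feas P i = {v \<in> block P i. (\<forall>j\<in>eqs P i. mp_eval v (con P i j) = 0) \<and>
                              (\<forall>j\<in>ineqs P i. mp_eval v (con P i j) \<ge> 0)}"

definition NE :: "('p, 'n::finite, 'j) nep \<Rightarrow> (real ^ 'n) set" where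
  "NE P = {x. \<forall>i. is_arg_min (\<lambda>v. mp_eval (replace P i v x) (obj P i))
                             (\<lambda>v. v \<in> feas P i) (strat P i x)}"

text \<open>
  The matrix polynomial \<open>G\<^sub>i\<close>, whose rows are indexed by coordinates and by constraints, padded by
  zero rows and columns for the indices not belonging to player \<open>i\<close>. (The upper rows of foreign
  coordinates are zero if \<^term>\<open>nep P\<close> holds, as the constraints do not contain these variables.)
  The padding does not affect the rank.
\<close>

definition G_mat ::
  "('p, 'n::finite, 'j::finite) nep \<Rightarrow> 'p \<Rightarrow> ('n mpoly) ^ 'j ^ ('n + 'j)" where
  "G_mat P i = (\<chi> r j. if j \<notin> cons P i then 0 else
     (case r of Inl k \<Rightarrow> if k \<in> coords P i then mp_diff k (con P i j) else 0
              | Inr l \<Rightarrow> if l = j then con P i j else 0))"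

definition nonsingular :: "('p, 'n::finite, 'j::finite) nep \<Rightarrow> 'p \<Rightarrow> bool" where
  "nonsingular P i \<longleftrightarrow> (\<forall>z :: complex ^ 'n. z \<in> block P i \<longrightarrow>
     rank (map_matrix (mp_eval z) (G_mat P i)) = card (cons P i))"

text \<open>
  \<open>H\<close> has entries in \<open>\<real>[x\<^sub>i]\<close> and \<open>H G\<^sub>i\<close> is the identity matrix of size \<open>m\<^sub>i\<close>. Only the
  rows and columns of \<open>H\<close> belonging to player \<open>i\<close> are relevant, here and in the multipliers below:
  the others meet the padding of \<open>G\<^sub>i\<close> and of \<open>f_hat\<close>.
\<close>

definition left_inverse ::
  "('p, 'n::finite, 'j::finite) nep \<Rightarrow> 'p \<Rightarrow> ('n mpoly) ^ ('n + 'j) ^ 'j \<Rightarrow> bool" where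
  "left_inverse P i H \<longleftrightarrow>
     (\<forall>j r. mp_vars (H $ j $ r) \<subseteq> coords P i) \<and>
     (\<forall>j\<in>cons P i. \<forall>l\<in>cons P i. (H ** G_mat P i) $ j $ l = (if j = l then 1 else 0))"

definition f_hat ::
  "('p, 'n::finite, 'j) nep \<Rightarrow> 'p \<Rightarrow> real ^ 'n \<Rightarrow> real ^ ('n + 'j::finite)" where
  "f_hat P i x = (\<chi> r. case r of Inl k \<Rightarrow> if k \<in> coords P i then mp_eval x (mp_diff k (obj P i)) else 0
                               | Inr l \<Rightarrow> 0)"

definition multiplier ::
  "('p, 'n::finite, 'j::finite) nep \<Rightarrow> ('p \<Rightarrow> ('n mpoly) ^ ('n + 'j) ^ 'j) \<Rightarrow>
   'p \<Rightarrow> 'j \<Rightarrow> real ^ 'n \<Rightarrow> real" where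
  "multiplier P H i j x = (map_matrix (mp_eval (strat P i x)) (H i) *v f_hat P i x) $ j"

text \<open>The solutions of the system (K).\<close>

definition KKT ::
  "('p, 'n::finite, 'j::finite) nep \<Rightarrow> ('p \<Rightarrow> ('n mpoly) ^ ('n + 'j) ^ 'j) \<Rightarrow> (real ^ 'n) set" where
  "KKT P H = {x. \<forall>i.
     (\<forall>k\<in>coords P i. mp_eval x (mp_diff k (obj P i)) -
        (\<Sum>j\<in>cons P i. multiplier P H i j x * mp_eval (strat P i x) (mp_diff k (con P i j))) = 0) \<and>
     (\<forall>j\<in>eqs P i. mp_eval (strat P i x) (con P i j) = 0) \<and>
     (\<forall>j\<in>ineqs P i. multiplier P H i j x * mp_eval (strat P i x) (con P i j) = 0 \<and>
        mp_eval (strat P i x) (con P i j) \<ge> 0 \<and> multiplier P H i j x \<ge> 0)}"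

text \<open>
  \<open>[x]\<^sub>1 = (1, x)\<close>; the type \<^typ>\<open>'n option\<close> has \<open>n + 1\<close> elements, and \<^const>\<open>None\<close> is the
  index of the additional coordinate.
\<close>

definition ext1 :: "real ^ 'n \<Rightarrow> real ^ ('n option)" where
  "ext1 x = (\<chi> a. case a of None \<Rightarrow> 1 | Some k \<Rightarrow> x $ k)"

definition qf :: "real ^ ('n option) ^ ('n option) \<Rightarrow> real ^ 'n::finite \<Rightarrow> real" where
  "qf \<Theta> x = ext1 x \<bullet> (\<Theta> *v ext1 x)"

definition pos_def :: "real ^ 'm ^ 'm::finite \<Rightarrow> bool" where
  "pos_def A \<longleftrightarrow> transpose A = A \<and> (\<forall>v. v \<noteq> 0 \<longrightarrow> v \<bullet> (A *v v) > 0)"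

text \<open>
  The space of symmetric matrices is a null set within the space of all square matrices, so
  ``almost every'' has to refer to the Lebesgue measure of the former space. A symmetric matrix is
  the same as a family of reals indexed by the unordered pairs (including singletons) of indices.
\<close>

definition sym_matrix :: "('m set \<Rightarrow> real) \<Rightarrow> real ^ 'm ^ 'm" where
  "sym_matrix \<theta> = (\<chi> a b. \<theta> {a, b})"

definition generic_pos_def :: "(real ^ 'm ^ 'm::finite \<Rightarrow> bool) \<Rightarrow> bool" where
  "generic_pos_def Q \<longleftrightarrow>
     (AE \<theta> in Pi\<^sub>M {{a, b} | a b :: 'm. True} (\<lambda>_. lborel).
        pos_def (sym_matrix \<theta>) \<longrightarrow> Q (sym_matrix \<theta>))"

text \<open>The feasible sets of the problems (U), \<open>(U\<^sub>\<delta>)\<close> and \<open>(M\<^sub>\<delta>)\<close>.\<close>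

definition U_feas ::
  "('p, 'n::finite, 'j::finite) nep \<Rightarrow> ('p \<Rightarrow> ('n mpoly) ^ ('n + 'j) ^ 'j) \<Rightarrow>
   ('p \<Rightarrow> (real ^ 'n) set) \<Rightarrow> (real ^ 'n) set" where
  "U_feas P H K = {x \<in> KKT P H. \<forall>i. \<forall>v\<in>K i.
     mp_eval (replace P i v x) (obj P i) - mp_eval x (obj P i) \<ge> 0}"

definition U\<delta>_feas where
  "U\<delta>_feas P H \<Theta> K xs \<delta> = {x \<in> U_feas P H K. qf \<Theta> x \<ge> qf \<Theta> xs + \<delta>}"

definition M\<delta>_feas where
  "M\<delta>_feas P H \<Theta> K xs \<delta> = {x \<in> U_feas P H K. qf \<Theta> x \<le> qf \<Theta> xs + \<delta>}"

definition L_obj :: "('p, 'n::finite, 'j) nep \<Rightarrow> 'p \<Rightarrow> real ^ 'n \<Rightarrow> real ^ 'n \<Rightarrow> real" where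
  "L_obj P i u v = mp_eval (replace P i v u) (obj P i) - mp_eval u (obj P i)"

definition L_opt :: "('p, 'n::finite, 'j) nep \<Rightarrow> 'p \<Rightarrow> real ^ 'n \<Rightarrow> (real ^ 'n) set" where
  "L_opt P i u = {v. is_arg_min (L_obj P i u) (\<lambda>v. v \<in> feas P i) v}"

definition L_solvable :: "('p, 'n::finite, 'j) nep \<Rightarrow> real ^ 'n \<Rightarrow> bool" where
  "L_solvable P u \<longleftrightarrow> (\<forall>i. L_opt P i u \<noteq> {})"

text \<open>Only meaningful if \<^term>\<open>L_opt P i u \<noteq> {}\<close>.\<close>

definition \<omega> :: "('p, 'n::finite, 'j) nep \<Rightarrow> 'p \<Rightarrow> real ^ 'n \<Rightarrow> real" where
  "\<omega> P i u = L_obj P i u (arg_min (L_obj P i u) (\<lambda>v. v \<in> feas P i))"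

definition enlarge ::
  "('p, 'n::finite, 'j) nep \<Rightarrow> real ^ 'n \<Rightarrow> ('p \<Rightarrow> (real ^ 'n) set) \<Rightarrow> ('p \<Rightarrow> (real ^ 'n) set) \<Rightarrow> bool" where
  "enlarge P u K K' \<longleftrightarrow>
     (\<forall>i. if \<omega> P i u < 0
          then \<exists>V. finite V \<and> V \<noteq> {} \<and> V \<subseteq> L_opt P i u \<and> K' i = K i \<union> V
          else K' i = K i)"

text \<open>
  The algorithms are nondeterministic transition systems: the optimizers in the global problems and
  the sets \<open>U\<^sub>i\<close> may be chosen arbitrarily. States are named after the step that is executed next.
  The constructor \<open>A_found\<close> is the output of an equilibrium together with the final sets
  \<open>K\<^sub>i\<close>. The steps solving the problems \<open>L\<^sub>i(u)\<close> have no transition unless these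
  problems have minimizers.
\<close>

datatype ('p, 'n) stateA =
    A1 "'p \<Rightarrow> (real ^ 'n) set"
  | A2 "'p \<Rightarrow> (real ^ 'n) set" "real ^ 'n"
  | A3 "'p \<Rightarrow> (real ^ 'n) set" "real ^ 'n"
  | A_found "'p \<Rightarrow> (real ^ 'n) set" "real ^ 'n"
  | A_none

inductive stepA ::
  "('p, 'n::finite, 'j::finite) nep \<Rightarrow> ('p \<Rightarrow> ('n mpoly) ^ ('n + 'j) ^ 'j) \<Rightarrow>
   real ^ ('n option) ^ ('n option) \<Rightarrow> ('p, 'n) stateA \<Rightarrow> ('p, 'n) stateA \<Rightarrow> bool"
  for P H \<Theta> where
  "U_feas P H K = {} \<Longrightarrow> stepA P H \<Theta> (A1 K) A_none"
| "is_arg_min (qf \<Theta>) (\<lambda>x. x \<in> U_feas P H K) u \<Longrightarrow> stepA P H \<Theta> (A1 K) (A2 K u)"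
| "L_solvable P u \<Longrightarrow> \<forall>i. \<omega> P i u \<ge> 0 \<Longrightarrow> stepA P H \<Theta> (A2 K u) (A_found K u)"
| "L_solvable P u \<Longrightarrow> \<exists>i. \<omega> P i u < 0 \<Longrightarrow> stepA P H \<Theta> (A2 K u) (A3 K u)"
| "enlarge P u K K' \<Longrightarrow> stepA P H \<Theta> (A3 K u) (A1 K')"

definition computed_by_A where
  "computed_by_A P H \<Theta> K x \<longleftrightarrow> (stepA P H \<Theta>)\<^sup>*\<^sup>* (A1 (\<lambda>i. {})) (A_found K x)"

datatype ('p, 'n) stateB =
    B1 real "'p \<Rightarrow> (real ^ 'n) set"
  | B2 real "'p \<Rightarrow> (real ^ 'n) set"
  | B3 real "'p \<Rightarrow> (real ^ 'n) set" "real ^ 'n"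
  | B4 real "'p \<Rightarrow> (real ^ 'n) set" "real ^ 'n"
  | B_found "real ^ 'n"
  | B_none

inductive stepB ::
  "('p, 'n::finite, 'j::finite) nep \<Rightarrow> ('p \<Rightarrow> ('n mpoly) ^ ('n + 'j) ^ 'j) \<Rightarrow>
   real ^ ('n option) ^ ('n option) \<Rightarrow> real ^ 'n \<Rightarrow> ('p, 'n) stateB \<Rightarrow> ('p, 'n) stateB \<Rightarrow> bool"
  for P H \<Theta> xs where
  "is_arg_max (qf \<Theta>) (\<lambda>x. x \<in> M\<delta>_feas P H \<Theta> K xs \<delta>) y \<Longrightarrow> qf \<Theta> y = qf \<Theta> xs \<Longrightarrow>
     stepB P H \<Theta> xs (B1 \<delta> K) (B2 \<delta> K)"
| "is_arg_max (qf \<Theta>) (\<lambda>x. x \<in> M\<delta>_feas P H \<Theta> K xs \<delta>) y \<Longrightarrow> qf \<Theta> y > qf \<Theta> xs \<Longrightarrow>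
     stepB P H \<Theta> xs (B1 \<delta> K) (B1 (\<delta> / 5) K)"
| "U\<delta>_feas P H \<Theta> K xs \<delta> = {} \<Longrightarrow> stepB P H \<Theta> xs (B2 \<delta> K) B_none"
| "is_arg_min (qf \<Theta>) (\<lambda>x. x \<in> U\<delta>_feas P H \<Theta> K xs \<delta>) u \<Longrightarrow>
     stepB P H \<Theta> xs (B2 \<delta> K) (B3 \<delta> K u)"
| "L_solvable P u \<Longrightarrow> \<forall>i. \<omega> P i u \<ge> 0 \<Longrightarrow> stepB P H \<Theta> xs (B3 \<delta> K u) (B_found u)"
| "L_solvable P u \<Longrightarrow> \<exists>i. \<omega> P i u < 0 \<Longrightarrow> stepB P H \<Theta> xs (B3 \<delta> K u) (B4 \<delta> K u)"
| "enlarge P u K K' \<Longrightarrow> stepB P H \<Theta> xs (B4 \<delta> K u) (B2 \<delta> K')"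

text \<open>
  Every run of \<open>step\<close> from \<open>s\<close> is finite, and every run that cannot be continued has ended in a
  state satisfying \<open>Q\<close>.
\<close>

definition terminates_with :: "('s \<Rightarrow> 's \<Rightarrow> bool) \<Rightarrow> 's \<Rightarrow> ('s \<Rightarrow> bool) \<Rightarrow> bool" where
  "terminates_with step s Q \<longleftrightarrow>
     (\<nexists>\<sigma> :: nat \<Rightarrow> 's. \<sigma> 0 = s \<and> (\<forall>t. step (\<sigma> t) (\<sigma> (Suc t)))) \<and>
     (\<forall>s'. step\<^sup>*\<^sup>* s s' \<and> (\<nexists>s''. step s' s'') \<longrightarrow> Q s')"

end

theory Submission
  imports Defs
begin

text \<open>
  Every Nash equilibrium is a KKT point and is never cut off by the sets \<open>K\<^sub>i\<close>, so the feasible set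
  of (U) always lies between \<open>NE\<close> and \<open>KKT\<close> and is one of finitely many sets. On a fixed set the
  minimizer of the quadratic form is unique for almost every \<open>\<Theta>\<close>; hence for generic \<open>\<Theta>\<close> the
  equilibrium \<open>x\<^sup>*\<close> is the unique minimizer of (U) for the final sets of Algorithm A. As \<open>x\<^sup>*\<close> is
  isolated and the form is coercive, all other feasible points have values exceeding that of \<open>x\<^sup>*\<close>
  by some \<open>\<epsilon> > 0\<close>. Therefore \<open>\<delta>\<close> is decreased only finitely often, and once it is accepted the
  problem \<open>(U\<^sub>\<delta>)\<close> excludes just \<open>x\<^sup>*\<close>. Every later round that does not stop cuts off one of the
  finitely many KKT points that are not equilibria.
\<close>

section \<open>Polynomials\<close>

text \<open>Cancellation may shrink the support of \<open>p + q\<close>, so additivity is proved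
  with sums over a common larger index set.\<close>

lemma mp_eval_eq_sum_superset:
  assumes "finite A" "Poly_Mapping.keys p \<subseteq> A"
  shows "mp_eval x p = (\<Sum>m\<in>A.
     of_real (Poly_Mapping.lookup p m) * (\<Prod>k\<in>UNIV. (x $ k) ^ Poly_Mapping.lookup m k))"
  unfolding mp_eval_def using assms
  by (intro sum.mono_neutral_left) (auto simp: in_keys_iff)

lemma mp_eval_0 [simp]: "mp_eval x 0 = 0"
  by (simp add: mp_eval_def)

lemma mp_eval_add: "mp_eval x (p + q) = mp_eval x p + mp_eval x q"
proof -
  let ?A = "Poly_Mapping.keys p \<union> Poly_Mapping.keys q"
  have "Poly_Mapping.keys (p + q) \<subseteq> ?A"
    by (rule Poly_Mapping.keys_add)
  then show ?thesis
    by (simp add: mp_eval_eq_sum_superset[of ?A] lookup_add distrib_right sum.distrib)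
qed

lemma mp_eval_sum: "mp_eval x (\<Sum>a\<in>A. p a) = (\<Sum>a\<in>A. mp_eval x (p a))"
  by (induction A rule: infinite_finite_induct) (simp_all add: mp_eval_add)

lemma mp_eval_single:
  "mp_eval x (Poly_Mapping.single m c) = of_real c * (\<Prod>k\<in>UNIV. (x $ k) ^ Poly_Mapping.lookup m k)"
  by (simp add: mp_eval_def)

lemma mp_eval_1 [simp]: "mp_eval x 1 = 1"
  by (simp add: single_one[symmetric] mp_eval_single del: single_one)

lemma sum_monomials:
  "(\<Sum>m\<in>Poly_Mapping.keys p. Poly_Mapping.single m (Poly_Mapping.lookup p m)) = p"
  by (rule poly_mapping_eqI)
    (auto simp: lookup_sum lookup_single when_def in_keys_iff sum.delta)

text \<open>Exponents add when monomials are multiplied; expanding both factors by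
  \<open>sum_monomials\<close> extends this bilinearly.\<close>

lemma mp_eval_mult: "mp_eval x (p * q) = mp_eval x p * mp_eval x q"
proof -
  have *: "mp_eval x (Poly_Mapping.single m c * Poly_Mapping.single m' c') =
     mp_eval x (Poly_Mapping.single m c) * mp_eval x (Poly_Mapping.single m' c')" for m m' c c'
    by (simp add: mult_single mp_eval_single lookup_add power_add prod.distrib)
  have "mp_eval x ((\<Sum>m\<in>Poly_Mapping.keys p. Poly_Mapping.single m (Poly_Mapping.lookup p m)) *
      (\<Sum>m\<in>Poly_Mapping.keys q. Poly_Mapping.single m (Poly_Mapping.lookup q m))) =
     mp_eval x (\<Sum>m\<in>Poly_Mapping.keys p. Poly_Mapping.single m (Poly_Mapping.lookup p m)) *
     mp_eval x (\<Sum>m\<in>Poly_Mapping.keys q. Poly_Mapping.single m (Poly_Mapping.lookup q m))"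
    by (simp only: sum_product mp_eval_sum *)
  then show ?thesis
    by (simp only: sum_monomials)
qed

lemma continuous_on_mp_eval [continuous_intros]:
  fixes f :: "'b::topological_space \<Rightarrow> real ^ 'n::finite"
  assumes "continuous_on S f"
  shows "continuous_on S (\<lambda>x. mp_eval (f x) p)"
  unfolding mp_eval_def by (intro continuous_intros assms)

lemma DERIV_mp_eval:
  fixes x :: "real ^ 'n::finite"
  shows "((\<lambda>t. mp_eval (x + t *\<^sub>R axis k 1) p) has_real_derivative mp_eval x (mp_diff k p)) (at 0)"
proof -
  have *: "((\<lambda>t. \<Prod>l\<in>UNIV. ((x + t *\<^sub>R axis k 1) $ l) ^ Poly_Mapping.lookup m l) has_real_derivative
     real (Poly_Mapping.lookup m k) *
       (\<Prod>l\<in>UNIV. (x $ l) ^ Poly_Mapping.lookup (m - Poly_Mapping.single k 1) l)) (at 0)"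
    for m :: "'n \<Rightarrow>\<^sub>0 nat"
  proof -
    let ?c = "\<Prod>l\<in>UNIV - {k}. (x $ l) ^ Poly_Mapping.lookup m l"
    \<comment> \<open>If the exponent of \<open>k\<close> is 0, the truncated subtraction keeps it
      at 0; this is harmless because the factor \<open>Poly_Mapping.lookup m k\<close>
      vanishes.\<close>
    have "((\<lambda>t. (x $ k + t) ^ Poly_Mapping.lookup m k * ?c) has_real_derivative
      real (Poly_Mapping.lookup m k) * ((x $ k) ^ (Poly_Mapping.lookup m k - 1) * ?c)) (at 0)"
      by (auto intro!: derivative_eq_intros)
    moreover have "(\<Prod>l\<in>UNIV. ((x + t *\<^sub>R axis k 1) $ l) ^ Poly_Mapping.lookup m l) =
        (x $ k + t) ^ Poly_Mapping.lookup m k * ?c" for t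
      by (subst prod.remove[of _ k]) (auto simp: axis_def intro!: prod.cong)
    moreover have "(\<Prod>l\<in>UNIV. (x $ l) ^ Poly_Mapping.lookup (m - Poly_Mapping.single k 1) l) =
        (x $ k) ^ (Poly_Mapping.lookup m k - 1) * ?c"
      by (subst prod.remove[of _ k])
        (auto simp: lookup_minus lookup_single intro!: prod.cong)
    ultimately show ?thesis
      by simp
  qed
  have "((\<lambda>t. mp_eval (x + t *\<^sub>R axis k 1) p) has_real_derivative
     (\<Sum>m\<in>Poly_Mapping.keys p. Poly_Mapping.lookup p m * (real (Poly_Mapping.lookup m k) *
       (\<Prod>l\<in>UNIV. (x $ l) ^ Poly_Mapping.lookup (m - Poly_Mapping.single k 1) l)))) (at 0)"
    unfolding mp_eval_def by (intro DERIV_sum) (use DERIV_cmult[OF *] in simp)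
  also have "(\<Sum>m\<in>Poly_Mapping.keys p. Poly_Mapping.lookup p m * (real (Poly_Mapping.lookup m k) *
       (\<Prod>l\<in>UNIV. (x $ l) ^ Poly_Mapping.lookup (m - Poly_Mapping.single k 1) l))) =
     mp_eval x (mp_diff k p)"
    by (simp add: mp_diff_def mp_eval_sum mp_eval_single mult_ac)
  finally show ?thesis .
qed

section \<open>First-order conditions\<close>

text \<open>Squared negative parts serve as penalties for inequalities. Squaring removes the kink of
  \<open>min s 0\<close>, since the difference quotient at 0 is bounded by the absolute value of
  \<open>h\<close>.\<close>

lemma DERIV_min_square: "((\<lambda>s::real. (min s 0)\<^sup>2) has_real_derivative 2 * min s 0) (at s)"
proof -
  consider "s < 0" | "s > 0" | "s = 0" by linarith
  then show ?thesis
  proof cases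
    case 1
    have "((\<lambda>s::real. s\<^sup>2) has_real_derivative 2 * min s 0) (at s)"
      using 1 by (auto intro!: derivative_eq_intros)
    then show ?thesis
      by (rule has_field_derivative_transform_within_open[where S="{..<0}"]) (use 1 in auto)
  next
    case 2
    have "((\<lambda>s::real. 0) has_real_derivative 2 * min s 0) (at s)"
      using 2 by (auto intro!: derivative_eq_intros)
    then show ?thesis
      by (rule has_field_derivative_transform_within_open[where S="{0<..}"]) (use 2 in auto)
  next
    case 3
    have "\<bar>((min h 0)\<^sup>2 - (min 0 0)\<^sup>2) / h\<bar> \<le> \<bar>h\<bar>" for h :: real
      by (cases "h \<le> 0") (simp_all add: power2_eq_square)
    then have "((\<lambda>h::real. ((min h 0)\<^sup>2 - (min 0 0)\<^sup>2) / h) \<longlongrightarrow> 0) (at 0)"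
      by (intro Lim_null_comparison[OF _ tendsto_rabs_zero[OF tendsto_ident_at]])
        (simp only: real_norm_def eventually_True)
    then show ?thesis
      using 3 by (simp add: DERIV_def)
  qed
qed

text \<open>
  A minimizer \<open>x\<close> is approximated by minimizers \<open>v\<^sub>N\<close> of the quadratic penalty function with
  weight \<open>N\<close>. Stationarity of \<open>v\<^sub>N\<close> provides approximate multipliers \<open>- 2 N p\<^sub>j(v\<^sub>N)\<close>; the left
  inverse expresses them through quantities converging to those in the conclusion, because
  \<open>N (p\<^sub>j(v\<^sub>N))\<^sup>2\<close> tends to 0.
\<close>

lemma kkt_of_left_inverse:
  fixes \<phi> :: "real ^ 'n::finite \<Rightarrow> real" and g :: "'j \<Rightarrow> real ^ 'n \<Rightarrow> real"
    and D\<phi> :: "'n \<Rightarrow> real ^ 'n \<Rightarrow> real" and Dg :: "'n \<Rightarrow> 'j \<Rightarrow> real ^ 'n \<Rightarrow> real"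
  assumes fin: "finite E" "finite I" and disj: "E \<inter> I = {}"
    and cont: "continuous_on UNIV \<phi>" "\<And>j. continuous_on UNIV (g j)"
      "\<And>k. continuous_on UNIV (D\<phi> k)" "\<And>k j. continuous_on UNIV (Dg k j)"
      "\<And>j k. continuous_on UNIV (h j k)" "\<And>j l. continuous_on UNIV (h' j l)"
    and D\<phi>: "\<And>k v. k \<in> C \<Longrightarrow> ((\<lambda>t. \<phi> (v + t *\<^sub>R axis k 1)) has_real_derivative D\<phi> k v) (at 0)"
    and Dg: "\<And>k v j. k \<in> C \<Longrightarrow> ((\<lambda>t. g j (v + t *\<^sub>R axis k 1)) has_real_derivative Dg k j v) (at 0)"
    and inverse: "\<And>j l v. j \<in> E \<union> I \<Longrightarrow> l \<in> E \<union> I \<Longrightarrow>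
       (\<Sum>k\<in>C. h j k v * Dg k l v) + h' j l v * g l v = (if j = l then 1 else 0)"
    and feas: "\<And>j. j \<in> E \<Longrightarrow> g j x = 0" "\<And>j. j \<in> I \<Longrightarrow> g j x \<ge> 0"
    and minimal: "\<And>v. (\<And>j. j \<in> E \<Longrightarrow> g j v = 0) \<Longrightarrow> (\<And>j. j \<in> I \<Longrightarrow> g j v \<ge> 0) \<Longrightarrow> \<phi> x \<le> \<phi> v"
  defines "\<mu> \<equiv> \<lambda>j. \<Sum>k\<in>C. h j k x * D\<phi> k x"
  shows "k \<in> C \<Longrightarrow> D\<phi> k x = (\<Sum>j\<in>E \<union> I. \<mu> j * Dg k j x)"
    and "j \<in> I \<Longrightarrow> \<mu> j \<ge> 0"
    and "j \<in> I \<Longrightarrow> \<mu> j * g j x = 0"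
proof -
  \<comment> \<open>\<open>p\<close> measures the violation of a constraint, so that
    \<open>pen\<close> vanishes exactly at the feasible points.\<close>
  define p where "p j v = (if j \<in> E then g j v else min (g j v) 0)" for j v
  define pen where "pen v = (\<Sum>j\<in>E \<union> I. (p j v)\<^sup>2)" for v
  \<comment> \<open>The term \<open>(norm (v - x))\<^sup>2\<close> singles out \<open>x\<close>
    among possibly many minimizers of \<open>\<phi>\<close>; its gradient vanishes at
    \<open>x\<close> and leaves no trace in the limit.\<close>
  define \<Psi> where "\<Psi> N v = \<phi> v + (norm (v - x))\<^sup>2 + real N * pen v" for N v
  have cont_p: "continuous_on UNIV (p j)" for j
    unfolding p_def by (cases "j \<in> E") (auto intro!: continuous_intros cont)
  have cont_pen: "continuous_on UNIV pen"
    unfolding pen_def by (intro continuous_intros cont_p)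
  have cont_\<Psi>: "continuous_on UNIV (\<Psi> N)" for N
    unfolding \<Psi>_def by (intro continuous_intros cont cont_pen)
  have tend: "(\<lambda>n. f (w n)) \<longlonglongrightarrow> f y" if "continuous_on UNIV f" "w \<longlonglongrightarrow> y"
    for f :: "real ^ 'n \<Rightarrow> real" and w y
    using continuous_on_tendsto_compose[OF that] by simp
  have p_x: "p j x = 0" if "j \<in> E \<union> I" for j
    using that feas by (auto simp: p_def)
  have pen_x: "pen x = 0"
    by (simp add: pen_def p_x)
  have pen_nonneg: "pen v \<ge> 0" for v
    by (simp add: pen_def sum_nonneg)
  \<comment> \<open>Minimizing over a ball secures existence. The ball is no restriction in the end,
    because the limit turns out to be its centre.\<close>
  have "\<exists>v\<in>cball x 1. \<forall>w\<in>cball x 1. \<Psi> N v \<le> \<Psi> N w" for N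
    by (intro continuous_attains_inf continuous_on_subset[OF cont_\<Psi>]) auto
  then obtain v where v: "\<And>N. v N \<in> cball x 1" "\<And>N w. w \<in> cball x 1 \<Longrightarrow> \<Psi> N (v N) \<le> \<Psi> N w"
    by metis
  have \<Psi>v: "\<Psi> N (v N) \<le> \<phi> x" for N
    using v(2)[of x N] by (simp add: \<Psi>_def pen_x)
  obtain y r where y: "y \<in> cball x 1" and r: "strict_mono (r :: nat \<Rightarrow> nat)" and vr: "(v \<circ> r) \<longlonglongrightarrow> y"
    using compact_cball[of x 1] v(1) unfolding compact_def by blast
  define w where "w N = v (r N)" for N
  have w: "w \<longlonglongrightarrow> y"
    using vr by (simp add: w_def[abs_def] o_def)
  have r_inf: "filterlim (\<lambda>N. real (r N)) at_top sequentially"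
    using filterlim_subseq[OF r] filterlim_real_sequentially by (rule filterlim_compose[rotated])
  have pen_le: "real (r N) * pen (w N) \<le> \<phi> x - \<phi> (w N)" for N
    using \<Psi>v[of "r N"] unfolding \<Psi>_def w_def by (smt (verit) zero_le_power2)
  have "y = x"
  proof -
    \<comment> \<open>If \<open>pen y\<close> were positive, the left side of \<open>pen_le\<close>
      would diverge while its right side converges.\<close>
    have "pen y \<le> 0"
    proof (rule ccontr)
      assume "\<not> pen y \<le> 0"
      then have "filterlim (\<lambda>N. pen (w N) * real (r N)) at_top sequentially"
        by (intro filterlim_tendsto_pos_mult_at_top[OF tend[OF cont_pen w]] r_inf) auto
      then have "\<forall>\<^sub>F N in sequentially. pen (w N) * real (r N) \<ge> \<phi> x - \<phi> y + 1"
        by (simp add: filterlim_at_top)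
      moreover have "(\<lambda>N. \<phi> x - \<phi> (w N)) \<longlonglongrightarrow> \<phi> x - \<phi> y"
        by (intro tendsto_intros tend[OF cont(1)] w)
      then have "\<forall>\<^sub>F N in sequentially. \<phi> x - \<phi> (w N) < \<phi> x - \<phi> y + 1"
        by (rule order_tendstoD) auto
      ultimately have "\<forall>\<^sub>F N in sequentially. False"
        by eventually_elim (use pen_le in \<open>smt (verit) mult.commute\<close>)
      then show False by simp
    qed
    then have "pen y = 0"
      using pen_nonneg[of y] by simp
    then have *: "p j y = 0" if "j \<in> E \<union> I" for j
      using that fin by (auto simp: pen_def sum_nonneg_eq_0_iff)
    have "g j y = 0" if "j \<in> E" for j
      using that * by (metis UnI1 p_def)
    moreover have "g j y \<ge> 0" if "j \<in> I" for j
    proof -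
      have "j \<notin> E" "p j y = 0"
        using that disj * by auto
      then show ?thesis
        by (simp add: p_def min_def split: if_splits)
    qed
    ultimately have "\<phi> x \<le> \<phi> y"
      by (rule minimal)
    \<comment> \<open>Obtained from \<open>\<Psi>v\<close> by dropping the nonnegative penalty and
      passing to the limit; with \<open>\<phi> x \<le> \<phi> y\<close> it forces
      \<open>y = x\<close>.\<close>
    moreover have "\<phi> y + (norm (y - x))\<^sup>2 \<le> \<phi> x"
    proof (rule LIMSEQ_le_const2)
      show "(\<lambda>N. \<phi> (w N) + (norm (w N - x))\<^sup>2) \<longlonglongrightarrow> \<phi> y + (norm (y - x))\<^sup>2"
        by (intro tendsto_intros tend[OF cont(1)] w)
      have "\<phi> (w N) + (norm (w N - x))\<^sup>2 \<le> \<phi> x" for N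
        using \<Psi>v[of "r N"] pen_nonneg[of "w N"] unfolding \<Psi>_def w_def
        by (smt (verit) mult_nonneg_nonneg of_nat_0_le_iff)
      then show "\<exists>N. \<forall>n\<ge>N. \<phi> (w n) + (norm (w n - x))\<^sup>2 \<le> \<phi> x"
        by blast
    qed
    ultimately have "(norm (y - x))\<^sup>2 \<le> 0" by linarith
    then show "y = x" by simp
  qed
  with w have w: "w \<longlonglongrightarrow> x" by simp
  have Npen: "(\<lambda>N. real (r N) * pen (w N)) \<longlonglongrightarrow> 0"
  proof (rule tendsto_sandwich[OF _ _ tendsto_const])
    show "(\<lambda>N. \<phi> x - \<phi> (w N)) \<longlonglongrightarrow> 0"
      using tendsto_diff[OF tendsto_const tend[OF cont(1) w], of "\<phi> x"] by simp
  qed (use pen_le pen_nonneg in auto)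
  have Np: "(\<lambda>N. real (r N) * (p j (w N))\<^sup>2) \<longlonglongrightarrow> 0" if "j \<in> E \<union> I" for j
  proof (rule tendsto_sandwich[OF _ _ tendsto_const Npen])
    have "(p j (w N))\<^sup>2 \<le> pen (w N)" for N
      unfolding pen_def using fin that by (intro member_le_sum) auto
    then show "\<forall>\<^sub>F N in sequentially. real (r N) * (p j (w N))\<^sup>2 \<le> real (r N) * pen (w N)"
      by (intro always_eventually allI mult_left_mono) simp_all
  qed auto
  define m where "m j N = - 2 * real (r N) * p j (w N)" for j N
  \<comment> \<open>For an inequality, \<open>min (g j v) 0\<close> vanishes wherever it differs
    from \<open>g j v\<close>, so its product with \<open>g j v\<close> is its square.\<close>
  have m_g: "m j N * g j (w N) = - 2 * (real (r N) * (p j (w N))\<^sup>2)" for j N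
    by (auto simp: m_def p_def power2_eq_square min_def)
  have mg_lim: "(\<lambda>N. m j N * g j (w N)) \<longlonglongrightarrow> 0" if "j \<in> E \<union> I" for j
    unfolding m_g using tendsto_mult[OF tendsto_const Np[OF that], of "-2"] by simp
  \<comment> \<open>Inside the open ball, \<open>w N\<close> is an unconstrained local minimizer of
    \<open>\<Psi> (r N)\<close>.\<close>
  have stationary: "D\<phi> k (w N) + 2 * (w N - x) $ k = (\<Sum>j\<in>E \<union> I. m j N * Dg k j (w N))"
    if wN: "w N \<in> ball x 1" and k: "k \<in> C" for N k
  proof -
    let ?l = "\<lambda>t. w N + t *\<^sub>R axis k (1::real)"
    have "((\<lambda>t. (p j (?l t))\<^sup>2) has_real_derivative 2 * p j (w N) * Dg k j (w N)) (at 0)" for j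
    proof (cases "j \<in> E")
      case True
      then show ?thesis
        using Dg[OF k, of j "w N"] by (auto simp: p_def intro!: derivative_eq_intros)
    next
      case False
      have "((\<lambda>s. (min s 0)\<^sup>2) has_real_derivative 2 * min (g j (w N)) 0) (at (g j (?l 0)))"
        using DERIV_min_square[of "g j (w N)"] by simp
      from DERIV_chain2[OF this Dg[OF k, of j "w N"]] show ?thesis
        using False by (simp add: p_def)
    qed
    moreover have "(norm (?l t - x))\<^sup>2 = (norm (w N - x))\<^sup>2 + 2 * t * (w N - x) $ k + t\<^sup>2" for t
    proof -
      have "?l t - x = (w N - x) + t *\<^sub>R axis k 1" by simp
      then show ?thesis
        by (simp only: power2_norm_eq_inner inner_add_left inner_add_right inner_scaleR_left
             inner_scaleR_right inner_axis inner_axis' inner_axis_axis)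
          (simp add: power2_eq_square algebra_simps)
    qed
    then have "((\<lambda>t. (norm (?l t - x))\<^sup>2) has_real_derivative 2 * (w N - x) $ k) (at 0)"
      by (simp only:) (rule derivative_eq_intros refl | simp)+
    ultimately have "((\<lambda>t. \<Psi> (r N) (?l t)) has_real_derivative
        D\<phi> k (w N) + 2 * (w N - x) $ k +
        real (r N) * (\<Sum>j\<in>E \<union> I. 2 * p j (w N) * Dg k j (w N))) (at 0)"
      unfolding \<Psi>_def pen_def
      by (intro DERIV_add D\<phi>[OF k] DERIV_cmult DERIV_sum) (simp_all only:)
    moreover obtain d where d: "d > 0" "ball (w N) d \<subseteq> ball x 1"
      using openE[OF open_ball wN] by blast
    moreover have "\<Psi> (r N) (?l 0) \<le> \<Psi> (r N) (?l t)" if "\<bar>0 - t\<bar> < d" for t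
    proof -
      have "?l t \<in> ball (w N) d"
        using that by (simp add: dist_norm norm_axis_1)
      then have "?l t \<in> cball x 1"
        using d ball_subset_cball by blast
      then show ?thesis
        using v(2) by (simp add: w_def)
    qed
    ultimately have "D\<phi> k (w N) + 2 * (w N - x) $ k +
        real (r N) * (\<Sum>j\<in>E \<union> I. 2 * p j (w N) * Dg k j (w N)) = 0"
      by (intro DERIV_local_min) auto
    then show ?thesis
      by (simp add: m_def sum_negf sum_distrib_left mult_ac)
  qed
  have ev_ball: "\<forall>\<^sub>F N in sequentially. w N \<in> ball x 1"
    using w by (rule topological_tendstoD) auto
  have m_lim: "m j \<longlonglongrightarrow> \<mu> j" if j: "j \<in> E \<union> I" for j
  proof -
    \<comment> \<open>The left inverse solves the stationarity equations for \<open>m j N\<close>.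
      In \<open>R\<close> the multipliers occur only in products with \<open>g l (w N)\<close>,
      which tend to 0, so the limit of \<open>R\<close> is known before that of
      \<open>m j\<close>.\<close>
    define R where "R N = (\<Sum>k\<in>C. h j k (w N) * (D\<phi> k (w N) + 2 * (w N - x) $ k)) +
        (\<Sum>l\<in>E \<union> I. h' j l (w N) * (m l N * g l (w N)))" for N
    have "R \<longlonglongrightarrow> (\<Sum>k\<in>C. h j k x * (D\<phi> k x + 2 * (x - x) $ k)) + (\<Sum>l\<in>E \<union> I. h' j l x * 0)"
      unfolding R_def by (intro tendsto_intros tend[OF cont(3)] tend[OF cont(5)] tend[OF cont(6)] w mg_lim)
    then have "R \<longlonglongrightarrow> \<mu> j"
      by (simp add: \<mu>_def)
    moreover have "\<forall>\<^sub>F N in sequentially. R N = m j N"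
      using ev_ball
    proof eventually_elim
      case (elim N)
      have "R N = (\<Sum>k\<in>C. h j k (w N) * (\<Sum>l\<in>E \<union> I. m l N * Dg k l (w N))) +
        (\<Sum>l\<in>E \<union> I. h' j l (w N) * (m l N * g l (w N)))"
        unfolding R_def
        by (intro arg_cong2[where f="(+)"] sum.cong refl) (simp only: stationary[OF elim])
      also have "\<dots> = (\<Sum>l\<in>E \<union> I. m l N * ((\<Sum>k\<in>C. h j k (w N) * Dg k l (w N)) + h' j l (w N) * g l (w N)))"
        by (simp add: sum_distrib_left distrib_left sum.distrib mult_ac sum.swap[of _ C])
      also have "\<dots> = (\<Sum>l\<in>E \<union> I. m l N * (if j = l then 1 else 0))"
        by (intro sum.cong refl) (simp only: inverse[OF j])
      also have "\<dots> = m j N"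
        using fin j by (simp add: sum.delta if_distrib cong: if_cong)
      finally show ?case .
    qed
    ultimately show ?thesis
      by (rule Lim_transform_eventually)
  qed
  show "D\<phi> k x = (\<Sum>j\<in>E \<union> I. \<mu> j * Dg k j x)" if "k \<in> C"
  proof (rule LIMSEQ_unique)
    have "(\<lambda>N. D\<phi> k (w N) + 2 * (w N - x) $ k) \<longlonglongrightarrow> D\<phi> k x + 2 * (x - x) $ k"
      by (intro tendsto_intros tend[OF cont(3)] w)
    then show "(\<lambda>N. D\<phi> k (w N) + 2 * (w N - x) $ k) \<longlonglongrightarrow> D\<phi> k x" by simp
    have "(\<lambda>N. \<Sum>j\<in>E \<union> I. m j N * Dg k j (w N)) \<longlonglongrightarrow> (\<Sum>j\<in>E \<union> I. \<mu> j * Dg k j x)"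
      by (intro tendsto_intros tend[OF cont(4)] w m_lim)
    then show "(\<lambda>N. D\<phi> k (w N) + 2 * (w N - x) $ k) \<longlonglongrightarrow> (\<Sum>j\<in>E \<union> I. \<mu> j * Dg k j x)"
      by (rule Lim_transform_eventually)
        (use ev_ball stationary[OF _ that] in \<open>auto elim!: eventually_mono\<close>)
  qed
  show "\<mu> j \<ge> 0" if "j \<in> I"
  proof (rule LIMSEQ_le_const)
    show "m j \<longlonglongrightarrow> \<mu> j" using m_lim that by simp
    show "\<exists>N. \<forall>n\<ge>N. 0 \<le> m j n"
      using that disj by (auto simp: m_def p_def mult_nonneg_nonpos)
  qed
  show "\<mu> j * g j x = 0" if "j \<in> I"
    using LIMSEQ_unique[OF tendsto_mult[OF m_lim[of j] tend[OF cont(2)[of j] w]] mg_lim[of j]] that by simp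
qed

section \<open>Blocks of the players, polynomial multipliers and the KKT set\<close>

lemma sum_Plus_UNIV:
  fixes f :: "'a::finite + 'b::finite \<Rightarrow> 'c::comm_monoid_add"
  shows "(\<Sum>r\<in>UNIV. f r) = (\<Sum>k\<in>UNIV. f (Inl k)) + (\<Sum>l\<in>UNIV. f (Inr l))"
  by (simp add: UNIV_Plus_UNIV[symmetric] sum.Plus del: UNIV_Plus_UNIV)

lemma replace_strat [simp]: "replace P i (strat P i v) x = replace P i v x"
  by (simp add: replace_def strat_def vec_eq_iff)

lemma replace_self [simp]: "replace P i x x = x"
  by (simp add: replace_def vec_eq_iff)

lemma strat_in_block: "strat P i x \<in> block P i"
  by (simp add: strat_def block_def)

lemma strat_add_axis:
  "k \<in> coords P i \<Longrightarrow> strat P i (v + t *\<^sub>R axis k 1) = strat P i v + t *\<^sub>R axis k (1::real)"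
  by (auto simp: strat_def vec_eq_iff axis_def)

lemma replace_add_axis:
  "k \<in> coords P i \<Longrightarrow> replace P i (v + t *\<^sub>R axis k 1) x = replace P i v x + t *\<^sub>R axis k (1::real)"
  by (auto simp: replace_def vec_eq_iff axis_def)

lemma continuous_on_strat [continuous_intros]:
  "continuous_on S f \<Longrightarrow> continuous_on S (\<lambda>x. strat P i (f x :: real ^ 'n::finite))"
  unfolding strat_def
  by (intro continuous_on_vec_lambda, rename_tac k, case_tac "k \<in> coords P i")
    (simp_all add: continuous_intros)

lemma continuous_on_replace [continuous_intros]:
  "continuous_on S f \<Longrightarrow> continuous_on S g \<Longrightarrow>
   continuous_on S (\<lambda>x. replace P i (f x) (g x) :: real ^ 'n::finite)"
  unfolding replace_def
  by (intro continuous_on_vec_lambda, rename_tac k, case_tac "k \<in> coords P i")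
    (simp_all add: continuous_intros)

text \<open>The constraint rows of \<open>f_hat\<close> are zero, so only the coordinate columns of
  \<open>H i\<close> contribute. This is the form of \<open>\<mu>\<close> in
  \<open>kkt_of_left_inverse\<close>.\<close>

lemma multiplier_eq:
  fixes P :: "('p, 'n::finite, 'j::finite) nep"
  shows "multiplier P H i j x = (\<Sum>k\<in>coords P i.
    mp_eval (strat P i x) (H i $ j $ Inl k) * mp_eval x (mp_diff k (obj P i)))"
proof -
  have "multiplier P H i j x = (\<Sum>k\<in>UNIV. mp_eval (strat P i x) (H i $ j $ Inl k) *
     (if k \<in> coords P i then mp_eval x (mp_diff k (obj P i)) else 0))"
    by (simp add: multiplier_def matrix_vector_mult_def map_matrix_def f_hat_def sum_Plus_UNIV)
  also have "\<dots> = (\<Sum>k\<in>UNIV. if k \<in> coords P i then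
     mp_eval (strat P i x) (H i $ j $ Inl k) * mp_eval x (mp_diff k (obj P i)) else 0)"
    by (intro sum.cong) auto
  finally show ?thesis
    by (simp add: sum.If_cases)
qed

lemma continuous_on_multiplier [continuous_intros]:
  "continuous_on S (multiplier P H i j)"
  unfolding multiplier_eq[abs_def] by (intro continuous_intros)

lemma closed_Collect_ball: "(\<And>a. a \<in> A \<Longrightarrow> closed {x. Q a x}) \<Longrightarrow> closed {x. \<forall>a\<in>A. Q a x}"
  by (auto simp: Collect_ball_eq)

text \<open>The multipliers are continuous functions of \<open>x\<close> rather than additional
  unknowns, so (K) consists of closed conditions.\<close>

lemma closed_KKT: "closed (KKT P H)"
  unfolding KKT_def
  by (intro closed_Collect_all closed_Collect_conj closed_Collect_ball closed_Collect_eq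
      closed_Collect_le continuous_intros)

lemma closed_U_feas: "closed (U_feas P H K)"
proof -
  have "closed {x. \<forall>i. \<forall>v\<in>K i. mp_eval (replace P i v x) (obj P i) - mp_eval x (obj P i) \<ge> 0}"
    by (intro closed_Collect_all closed_Collect_ball closed_Collect_le continuous_intros)
  then have "closed (KKT P H \<inter>
     {x. \<forall>i. \<forall>v\<in>K i. mp_eval (replace P i v x) (obj P i) - mp_eval x (obj P i) \<ge> 0})"
    by (intro closed_Int closed_KKT)
  then show ?thesis
    by (simp add: U_feas_def Int_def)
qed

lemma KKT_strat_feas: "x \<in> KKT P H \<Longrightarrow> strat P i x \<in> feas P i"
  by (auto simp: KKT_def feas_def strat_in_block)

text \<open>Evaluation is a ring homomorphism, and the diagonal lower block of \<open>G_mat\<close>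
  leaves a single constraint term.\<close>

lemma left_inverse_eval:
  fixes P :: "('p, 'n::finite, 'j::finite) nep"
  assumes H: "left_inverse P i H" and j: "j \<in> cons P i" and l: "l \<in> cons P i"
  shows "(\<Sum>k\<in>coords P i. mp_eval z (H $ j $ Inl k) * mp_eval z (mp_diff k (con P i l))) +
     mp_eval z (H $ j $ Inr l) * mp_eval z (con P i l) = (if j = l then 1 else 0)"
proof -
  have "(if j = l then 1 else 0) = mp_eval z ((H ** G_mat P i) $ j $ l)"
    using H j l by (simp add: left_inverse_def)
  also have "\<dots> = (\<Sum>k\<in>UNIV. if k \<in> coords P i then
        mp_eval z (H $ j $ Inl k) * mp_eval z (mp_diff k (con P i l)) else 0) +
     mp_eval z (H $ j $ Inr l) * mp_eval z (con P i l)"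
    using l by (simp add: matrix_matrix_mult_def G_mat_def sum_Plus_UNIV if_distrib mp_eval_add
        mp_eval_sum mp_eval_mult cong: if_cong)
  also have "(\<Sum>k\<in>UNIV. if k \<in> coords P i then
        mp_eval z (H $ j $ Inl k) * mp_eval z (mp_diff k (con P i l)) else 0) =
     (\<Sum>k\<in>coords P i. mp_eval z (H $ j $ Inl k) * mp_eval z (mp_diff k (con P i l)))"
    by (simp add: sum.If_cases)
  finally show ?thesis by simp
qed

text \<open>With the other players frozen at \<open>x\<close>, each block of \<open>x\<close> solves
  a minimization problem to which \<open>kkt_of_left_inverse\<close> applies; the left inverse takes
  the place of a constraint qualification.\<close>

lemma NE_subset_KKT:
  fixes P :: "('p, 'n::finite, 'j::finite) nep"
  assumes "nep P" and inv: "\<And>i. left_inverse P i (H i)"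
  shows "NE P \<subseteq> KKT P H"
proof
  fix x assume x: "x \<in> NE P"
  show "x \<in> KKT P H"
    unfolding KKT_def
  proof (intro CollectI allI)
    fix i
    have min: "is_arg_min (\<lambda>v. mp_eval (replace P i v x) (obj P i)) (\<lambda>v. v \<in> feas P i) (strat P i x)"
      using x by (simp add: NE_def)
    then have feas: "strat P i x \<in> feas P i"
      by (simp add: is_arg_min_def)
    \<comment> \<open>Since \<open>replace\<close> and \<open>strat\<close> read only the player's
      own coordinates of \<open>v\<close>, minimality over the block becomes minimality over joint
      vectors, the form used in \<open>kkt_of_left_inverse\<close>.\<close>
    have le: "mp_eval (replace P i x x) (obj P i) \<le> mp_eval (replace P i v x) (obj P i)"
      if "\<And>j. j \<in> eqs P i \<Longrightarrow> mp_eval (strat P i v) (con P i j) = 0"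
        "\<And>j. j \<in> ineqs P i \<Longrightarrow> mp_eval (strat P i v) (con P i j) \<ge> 0" for v
    proof -
      have "strat P i v \<in> feas P i"
        using that by (simp add: feas_def strat_in_block)
      then show ?thesis
        using min by (force simp: is_arg_min_linorder)
    qed
    have D\<phi>: "((\<lambda>t. mp_eval (replace P i (v + t *\<^sub>R axis k 1) x) (obj P i)) has_real_derivative
        mp_eval (replace P i v x) (mp_diff k (obj P i))) (at 0)" if "k \<in> coords P i" for k v
      using DERIV_mp_eval by (simp add: replace_add_axis[OF that])
    have Dg: "((\<lambda>t. mp_eval (strat P i (v + t *\<^sub>R axis k 1)) (con P i j)) has_real_derivative
        mp_eval (strat P i v) (mp_diff k (con P i j))) (at 0)" if "k \<in> coords P i" for k v j
      using DERIV_mp_eval by (simp add: strat_add_axis[OF that])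
    have disj: "eqs P i \<inter> ineqs P i = {}"
      using assms(1) by (simp add: nep_def)
    have cont: "continuous_on UNIV (\<lambda>v. mp_eval (replace P i v x) p)"
      "continuous_on UNIV (\<lambda>v. mp_eval (strat P i v) p :: real)" for p
      by (intro continuous_intros)+
    have feas': "j \<in> eqs P i \<Longrightarrow> mp_eval (strat P i x) (con P i j) = 0"
      "j \<in> ineqs P i \<Longrightarrow> mp_eval (strat P i x) (con P i j) \<ge> 0" for j
      using feas by (simp_all add: feas_def)
    note kkt = kkt_of_left_inverse[of "eqs P i" "ineqs P i"
        "\<lambda>v. mp_eval (replace P i v x) (obj P i)" "\<lambda>j v. mp_eval (strat P i v) (con P i j)"
        "\<lambda>k v. mp_eval (replace P i v x) (mp_diff k (obj P i))"
        "\<lambda>k j v. mp_eval (strat P i v) (mp_diff k (con P i j))"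
        "\<lambda>j k v. mp_eval (strat P i v) (H i $ j $ Inl k)"
        "\<lambda>j l v. mp_eval (strat P i v) (H i $ j $ Inr l)"
        "coords P i" x, OF finite finite disj cont(1) cont(2) cont(1) cont(2) cont(2) cont(2) D\<phi> Dg
        left_inverse_eval[OF inv, unfolded cons_def] feas' le, unfolded replace_self,
        folded multiplier_eq cons_def]
    have "mp_eval x (mp_diff k (obj P i)) =
       (\<Sum>j\<in>cons P i. multiplier P H i j x * mp_eval (strat P i x) (mp_diff k (con P i j)))"
      if "k \<in> coords P i" for k
      by (rule kkt(1)) (use that in simp_all)
    moreover have "multiplier P H i j x \<ge> 0" if "j \<in> ineqs P i" for j
      by (rule kkt(2)) (use that in simp_all)
    moreover have "multiplier P H i j x * mp_eval (strat P i x) (con P i j) = 0" if "j \<in> ineqs P i" for j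
      by (rule kkt(3)) (use that in simp_all)
    ultimately show "(\<forall>k\<in>coords P i. mp_eval x (mp_diff k (obj P i)) -
        (\<Sum>j\<in>cons P i. multiplier P H i j x * mp_eval (strat P i x) (mp_diff k (con P i j))) = 0) \<and>
     (\<forall>j\<in>eqs P i. mp_eval (strat P i x) (con P i j) = 0) \<and>
     (\<forall>j\<in>ineqs P i. multiplier P H i j x * mp_eval (strat P i x) (con P i j) = 0 \<and>
        mp_eval (strat P i x) (con P i j) \<ge> 0 \<and> multiplier P H i j x \<ge> 0)"
      using feas by (simp add: feas_def)
  qed
qed

section \<open>Generic quadratic forms\<close>

lemma qf_sym_matrix:
  "qf (sym_matrix \<theta>) x = (\<Sum>a\<in>UNIV. \<Sum>b\<in>UNIV. ext1 x $ a * ext1 x $ b * \<theta> {a, b})"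
  by (simp add: qf_def sym_matrix_def inner_vec_def matrix_vector_mult_def sum_distrib_left mult_ac)

text \<open>This entry of \<open>\<theta>\<close> sits at two mirrored places of the matrix, whence
  the factor 2, and it meets the constant coordinate 1 of \<open>ext1 x\<close>.\<close>

lemma qf_sym_matrix_upd:
  fixes k :: "'n::finite"
  shows "qf (sym_matrix (\<theta>({None, Some k} := t'))) x =
    qf (sym_matrix (\<theta>({None, Some k} := t))) x + 2 * (t' - t) * x $ k"
proof -
  let ?i = "{None, Some k}"
  have "qf (sym_matrix (\<theta>(?i := t'))) x - qf (sym_matrix (\<theta>(?i := t))) x =
      (\<Sum>a\<in>UNIV. \<Sum>b\<in>UNIV. ext1 x $ a * ext1 x $ b * ((\<theta>(?i := t')) {a, b} - (\<theta>(?i := t)) {a, b}))"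
    by (simp only: qf_sym_matrix sum_subtractf right_diff_distrib)
  also have "\<dots> = (\<Sum>a\<in>UNIV. \<Sum>b\<in>UNIV.
      (if b = Some k then if a = None then ext1 x $ a * ext1 x $ b * (t' - t) else 0 else 0) +
      (if b = None then if a = Some k then ext1 x $ a * ext1 x $ b * (t' - t) else 0 else 0))"
    by (intro sum.cong refl) (auto simp: doubleton_eq_iff)
  also have "\<dots> = 2 * (t' - t) * x $ k"
    by (simp add: sum.distrib ext1_def)
  finally show ?thesis by simp
qed

lemma continuous_on_qf [continuous_intros]: "continuous_on S (qf \<Theta>)"
proof -
  have "continuous_on S (\<lambda>x. ext1 x)"
    unfolding ext1_def
    by (intro continuous_on_vec_lambda, rename_tac a, case_tac a) (simp_all add: continuous_intros)
  moreover have "continuous_on S (\<lambda>x. \<Theta> *v ext1 x)"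
    using calculation by (rule linear_continuous_on_compose) (rule matrix_vector_mul_linear)
  ultimately show ?thesis
    unfolding qf_def[abs_def] by (intro continuous_intros)
qed

abbreviation sym_measure :: "('m::finite set \<Rightarrow> real) measure" where
  "sym_measure \<equiv> Pi\<^sub>M {{a, b} | a b. True} (\<lambda>_. lborel)"

lemma measurable_qf_sym_matrix [measurable]:
  fixes x :: "real ^ 'n::finite"
  shows "(\<lambda>\<theta>. qf (sym_matrix \<theta>) x) \<in> borel_measurable sym_measure"
proof -
  have "(\<lambda>\<theta>. \<theta> {a, b}) \<in> borel_measurable sym_measure" for a b :: "'n option"
  proof -
    have "{a, b} \<in> {{a, b} | a b. True}" by blast
    from measurable_component_singleton[OF this, of "\<lambda>_. lborel :: real measure"] show ?thesis
      by simp
  qed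
  then show ?thesis
    unfolding qf_sym_matrix by (intro borel_measurable_sum borel_measurable_times) auto
qed

text \<open>
  When the entry of \<open>\<Theta>\<close> at \<open>(1, x\<^sub>k)\<close> varies, the difference of the two infima is strictly
  monotone, so that they coincide at most once on each line.
\<close>

lemma null_set_equal_infima:
  fixes k :: "'n::finite"
  assumes DE: "countable D" "countable E"
    and D: "\<And>x. x \<in> D \<Longrightarrow> x $ k \<le> r" and E: "\<And>y. y \<in> E \<Longrightarrow> s \<le> y $ k" and "r < s"
  shows "{\<theta> \<in> space sym_measure.
     (INF x\<in>D. ereal (qf (sym_matrix \<theta>) x)) = (INF y\<in>E. ereal (qf (sym_matrix \<theta>) y)) \<and>
     \<bar>INF x\<in>D. ereal (qf (sym_matrix \<theta>) x)\<bar> \<noteq> \<infinity>} \<in> null_sets sym_measure" (is "?S \<in> _")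
proof -
  define S where "S = ?S"
  let ?I = "{{a, b} | a b :: 'n option. True}" and ?i = "{None, Some k}"
  \<comment> \<open>Infima are extended reals because \<open>\<theta>\<close> runs over all
    symmetric matrices, definite or not, and because the sets may be empty.\<close>
  define f where "f D \<theta> = (INF x\<in>D. ereal (qf (sym_matrix \<theta>) x))"
    for D :: "(real ^ 'n) set" and \<theta>
  have meas_f: "f D \<in> borel_measurable sym_measure" "f E \<in> borel_measurable sym_measure"
    unfolding f_def by (intro borel_measurable_INF DE borel_measurable_ereal measurable_qf_sym_matrix)+
  have S_iff: "\<theta> \<in> S \<longleftrightarrow> \<theta> \<in> space sym_measure \<and> f D \<theta> = f E \<theta> \<and> \<bar>f D \<theta>\<bar> \<noteq> \<infinity>" for \<theta>
    by (simp add: S_def f_def)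
  have "S = {\<theta> \<in> space sym_measure. f D \<theta> = f E \<theta> \<and> \<bar>f D \<theta>\<bar> \<noteq> \<infinity>}"
    by (rule set_eqI) (simp only: S_iff mem_Collect_eq)
  also have "\<dots> \<in> sets sym_measure"
    by (intro sets.sets_Collect_conj borel_measurable_eq borel_measurable_neq
        borel_measurable_ereal_abs meas_f borel_measurable_const)
  finally have meas: "S \<in> sets sym_measure" .
  \<comment> \<open>Raising the entry by \<open>t' - t\<close> raises the infimum over
    \<open>D\<close> by at most \<open>2 * (t' - t) * r\<close> and that over \<open>E\<close> by at
    least \<open>2 * (t' - t) * s\<close>, so two finite coincidences would give
    \<open>s \<le> r\<close>.\<close>
  have not_lt: "\<not> t < t'" if t: "\<theta>(?i := t) \<in> S" and t': "\<theta>(?i := t') \<in> S" for \<theta> t t'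
  proof
    assume "t < t'"
    obtain m where m: "f D (\<theta>(?i := t)) = ereal m" "f E (\<theta>(?i := t)) = ereal m"
      using t unfolding S_iff by (cases "f D (\<theta>(?i := t))") (auto dest: sym)
    obtain m' where m': "f D (\<theta>(?i := t')) = ereal m'" "f E (\<theta>(?i := t')) = ereal m'"
      using t' unfolding S_iff by (cases "f D (\<theta>(?i := t'))") (auto dest: sym)
    have lower: "m0 \<le> qf (sym_matrix \<theta>) x" if "f A \<theta> = ereal m0" "x \<in> A" for A \<theta> m0 x
      using INF_lower[OF that(2), of "\<lambda>x. ereal (qf (sym_matrix \<theta>) x)"] that(1) by (simp add: f_def)
    have greatest: "c \<le> m0" if "f A \<theta> = ereal m0" "\<And>x. x \<in> A \<Longrightarrow> c \<le> qf (sym_matrix \<theta>) x" for A \<theta> m0 c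
      using INF_greatest[of A "ereal c" "\<lambda>x. ereal (qf (sym_matrix \<theta>) x)"] that by (simp add: f_def)
    have "m' - 2 * (t' - t) * r \<le> m"
    proof (rule greatest[OF m(1)])
      fix x assume x: "x \<in> D"
      have "2 * (t' - t) * x $ k \<le> 2 * (t' - t) * r"
        using D[OF x] \<open>t < t'\<close> by (intro mult_left_mono) auto
      then show "m' - 2 * (t' - t) * r \<le> qf (sym_matrix (\<theta>(?i := t))) x"
        using lower[OF m'(1) x] qf_sym_matrix_upd[of \<theta> k t' x t] by linarith
    qed
    moreover have "m + 2 * (t' - t) * s \<le> m'"
    proof (rule greatest[OF m'(2)])
      fix y assume y: "y \<in> E"
      have "2 * (t' - t) * s \<le> 2 * (t' - t) * y $ k"
        using E[OF y] \<open>t < t'\<close> by (intro mult_left_mono) auto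
      then show "m + 2 * (t' - t) * s \<le> qf (sym_matrix (\<theta>(?i := t'))) y"
        using lower[OF m(2) y] qf_sym_matrix_upd[of \<theta> k t' y t] by linarith
    qed
    ultimately have "2 * (t' - t) * s \<le> 2 * (t' - t) * r"
      by linarith
    moreover have "2 * (t' - t) * r < 2 * (t' - t) * s"
      using \<open>t < t'\<close> \<open>r < s\<close> by (intro mult_strict_left_mono) auto
    ultimately show False by linarith
  qed
  have inner: "(\<integral>\<^sup>+ t. indicator S (\<theta>(?i := t)) \<partial>lborel) = 0" for \<theta>
  proof -
    have "countable {t. \<theta>(?i := t) \<in> S}"
    proof (cases "{t. \<theta>(?i := t) \<in> S} = {}")
      case False
      then obtain t0 where "\<theta>(?i := t0) \<in> S" by blast
      then have "{t. \<theta>(?i := t) \<in> S} \<subseteq> {t0}"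
        using not_lt by (blast intro: antisym leI)
      then show ?thesis
        by (rule countable_subset) simp
    qed (simp only: countable_empty)
    then have "AE t in lborel. t \<notin> {t. \<theta>(?i := t) \<in> S}"
      by (intro AE_not_in countable_imp_null_set_lborel)
    then have "AE t in lborel. indicator S (\<theta>(?i := t)) = (0 :: ennreal)"
      by eventually_elim simp
    from nn_integral_cong_AE[OF this] show ?thesis by simp
  qed
  interpret product_sigma_finite "\<lambda>_ :: 'n option set. lborel :: real measure" ..
  \<comment> \<open>Splitting off the index \<open>?i\<close> lets Tonelli integrate along that
    coordinate first, where every slice is null by \<open>inner\<close>.\<close>
  have I: "insert ?i (?I - {?i}) = ?I" by auto
  have "finite ?I"
    by (rule finite_subset[of _ UNIV]) auto
  then have "(\<integral>\<^sup>+ \<theta>. indicator S \<theta> \<partial>Pi\<^sub>M (insert ?i (?I - {?i})) (\<lambda>_. lborel)) =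
      (\<integral>\<^sup>+ \<theta>. (\<integral>\<^sup>+ t. indicator S (\<theta>(?i := t)) \<partial>lborel) \<partial>Pi\<^sub>M (?I - {?i}) (\<lambda>_. lborel))"
    by (intro product_nn_integral_insert borel_measurable_indicator) (simp_all only: I meas, simp_all)
  then have "emeasure sym_measure S = 0"
    using meas by (simp only: I inner nn_integral_indicator nn_integral_const mult_zero_left)
  then show ?thesis
    using meas unfolding S_def by (intro null_setsI)
qed

text \<open>Distinct minimizers differ in some coordinate \<open>k\<close> and are separated by
  rationals \<open>r < s\<close>, so the infima over the parts of \<open>F\<close> with
  \<open>x $ k \<le> r\<close> and with \<open>s \<le> x $ k\<close> are equal and finite. By
  \<open>null_set_equal_infima\<close> this is a null event for each of the countably many
  \<open>k\<close>, \<open>r\<close>, \<open>s\<close>.\<close>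

lemma AE_unique_minimizer:
  fixes F :: "(real ^ 'n::finite) set"
  shows "AE \<theta> in sym_measure. \<forall>x y. is_arg_min (qf (sym_matrix \<theta>)) (\<lambda>x. x \<in> F) x \<and>
     is_arg_min (qf (sym_matrix \<theta>)) (\<lambda>x. x \<in> F) y \<longrightarrow> x = y"
proof -
  let ?f = "\<lambda>D \<theta>. INF x\<in>D. ereal (qf (sym_matrix \<theta>) x)"
  \<comment> \<open>Countable dense subsets make the infima measurable, and by continuity of the
    form they leave minima unchanged.\<close>
  have "\<exists>D. countable D \<and> D \<subseteq> A \<and> A \<subseteq> closure D" for A :: "(real ^ 'n) set"
    by (rule separable[of A]) blast
  then obtain d where "\<forall>A :: (real ^ 'n) set. countable (d A) \<and> d A \<subseteq> A \<and> A \<subseteq> closure (d A)"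
    using choice[of "\<lambda>A D. countable D \<and> D \<subseteq> A \<and> A \<subseteq> closure D"] by blast
  then have d: "countable (d A)" "d A \<subseteq> A" "A \<subseteq> closure (d A)" for A
    by simp_all
  define D E where "D k r = d {x \<in> F. x $ k \<le> r}" and "E k s = d {x \<in> F. s \<le> x $ k}" for k r s
  have "AE \<theta> in sym_measure. \<forall>k. \<forall>r\<in>\<rat>. \<forall>s\<in>\<rat>. r < s \<longrightarrow>
      \<not> (?f (D k r) \<theta> = ?f (E k s) \<theta> \<and> \<bar>?f (D k r) \<theta>\<bar> \<noteq> \<infinity>)"
  proof (intro AE_all_countable[THEN iffD2] allI AE_ball_countable[THEN iffD2] countable_rat ballI)
    fix k :: 'n and r s :: real
    show "AE \<theta> in sym_measure. r < s \<longrightarrow>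
      \<not> (?f (D k r) \<theta> = ?f (E k s) \<theta> \<and> \<bar>?f (D k r) \<theta>\<bar> \<noteq> \<infinity>)"
    proof (cases "r < s")
      case True
      have D: "countable (D k r)" "\<And>x. x \<in> D k r \<Longrightarrow> x $ k \<le> r"
        using d(1,2)[of "{x \<in> F. x $ k \<le> r}"] unfolding D_def by blast+
      have E: "countable (E k s)" "\<And>x. x \<in> E k s \<Longrightarrow> s \<le> x $ k"
        using d(1,2)[of "{x \<in> F. s \<le> x $ k}"] unfolding E_def by blast+
      have "AE \<theta> in sym_measure. \<theta> \<notin> {\<theta> \<in> space sym_measure.
          ?f (D k r) \<theta> = ?f (E k s) \<theta> \<and> \<bar>?f (D k r) \<theta>\<bar> \<noteq> \<infinity>}"
        using null_set_equal_infima[OF D(1) E(1) D(2) E(2) True] by (rule AE_not_in)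
      with AE_space show ?thesis
        by eventually_elim (rule impI, erule contrapos_nn, rule CollectI, rule conjI, assumption+)
    qed simp
  qed
  then show ?thesis
  proof eventually_elim
    case (elim \<theta>)
    let ?q = "qf (sym_matrix \<theta>)"
    have INF_eq: "?f (d A) \<theta> = ereal (?q x)"
      if x: "is_arg_min ?q (\<lambda>x. x \<in> F) x" and A: "x \<in> A" "A \<subseteq> F" for x A
    proof (rule antisym)
      have "closed {z. ?f (d A) \<theta> \<le> ereal (?q z)}"
        by (intro closed_Collect_le continuous_on_const continuous_on_ereal continuous_on_qf)
      then have "closure (d A) \<subseteq> {z. ?f (d A) \<theta> \<le> ereal (?q z)}"
        by (rule closure_minimal[rotated]) (blast intro: INF_lower)
      then show "?f (d A) \<theta> \<le> ereal (?q x)"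
        using d(3)[of A] A by blast
      show "ereal (?q x) \<le> ?f (d A) \<theta>"
        using x A d(2)[of A] by (intro INF_greatest) (auto simp: is_arg_min_linorder)
    qed
    have not_less: "\<not> x $ k < y $ k"
      if x: "is_arg_min ?q (\<lambda>x. x \<in> F) x" and y: "is_arg_min ?q (\<lambda>x. x \<in> F) y" for x y k
    proof
      assume "x $ k < y $ k"
      then obtain r where r: "r \<in> \<rat>" "x $ k < r" "r < y $ k"
        using Rats_dense_in_real[of "x $ k" "y $ k"] by blast
      then obtain s where s: "s \<in> \<rat>" "r < s" "s < y $ k"
        using Rats_dense_in_real[of r "y $ k"] by blast
      have "?q x = ?q y"
        using x y by (intro antisym) (simp_all add: is_arg_min_linorder)
      moreover have "?f (D k r) \<theta> = ereal (?q x)"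
        unfolding D_def by (rule INF_eq[OF x]) (use x r in \<open>simp_all add: is_arg_min_def\<close>)
      moreover have "?f (E k s) \<theta> = ereal (?q y)"
        unfolding E_def by (rule INF_eq[OF y]) (use y s in \<open>simp_all add: is_arg_min_def\<close>)
      ultimately have "?f (D k r) \<theta> = ?f (E k s) \<theta> \<and> \<bar>?f (D k r) \<theta>\<bar> \<noteq> \<infinity>"
        by simp
      then show False
        using elim[rule_format, OF r(1) s(1,2), of k] by (rule notE[rotated])
    qed
    show ?case
    proof (intro allI impI)
      fix x y
      assume "is_arg_min ?q (\<lambda>x. x \<in> F) x \<and> is_arg_min ?q (\<lambda>x. x \<in> F) y"
      then have "x $ k = y $ k" for k
        using not_less[of x y k] not_less[of y x k] by linarith
      then show "x = y"
        by (simp add: vec_eq_iff)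
    qed
  qed
qed

section \<open>Coercivity of the form and existence of optimizers\<close>

text \<open>The constant is the minimum of the form on the compact unit sphere; homogeneity of
  degree 2 extends the bound.\<close>

lemma pos_def_lower_bound:
  fixes A :: "real ^ 'm ^ 'm::finite"
  assumes "pos_def A"
  obtains c where "c > 0" "\<And>v. c * (norm v)\<^sup>2 \<le> v \<bullet> (A *v v)"
proof -
  let ?q = "\<lambda>v. v \<bullet> (A *v v)"
  have "axis undefined 1 \<in> (sphere 0 1 :: (real ^ 'm) set)"
    by simp
  then have "sphere 0 1 \<noteq> ({} :: (real ^ 'm) set)"
    by blast
  moreover have "continuous_on (sphere 0 1) (\<lambda>v. A *v v)"
    by (rule linear_continuous_on_compose[OF continuous_on_id matrix_vector_mul_linear])
  then have "continuous_on (sphere 0 1) ?q"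
    by (intro continuous_on_inner continuous_on_id)
  ultimately obtain w where "w \<in> sphere 0 1" "\<forall>v\<in>sphere 0 1. ?q w \<le> ?q v"
    using continuous_attains_inf[OF compact_sphere] by blast
  then have w: "w \<in> sphere 0 1" "\<And>v. v \<in> sphere 0 1 \<Longrightarrow> ?q w \<le> ?q v"
    by blast+
  have "w \<noteq> 0"
    using w(1) by auto
  then have "?q w > 0"
    using assms by (simp add: pos_def_def)
  moreover have "?q w * (norm v)\<^sup>2 \<le> ?q v" for v
  proof (cases "v = 0")
    case False
    have "?q w \<le> ?q ((1 / norm v) *\<^sub>R v)"
      using False by (intro w(2)) simp
    also have "\<dots> = ?q v / (norm v)\<^sup>2"
      by (simp add: matrix_vector_mult_scaleR power2_eq_square)
    finally show ?thesis
      using False by (simp add: field_simps)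
  qed simp
  ultimately show ?thesis
    by (rule that)
qed

text \<open>The norm of \<open>ext1 x\<close> dominates that of \<open>x\<close>, so the lower bound
  for the homogeneous form makes \<open>qf \<Theta>\<close> coercive.\<close>

lemma bounded_qf_le:
  fixes \<Theta> :: "real ^ ('n::finite option) ^ ('n option)"
  assumes "pos_def \<Theta>"
  shows "bounded {x. qf \<Theta> x \<le> b}"
proof -
  obtain c where c: "c > 0" "\<And>v. c * (norm v)\<^sup>2 \<le> v \<bullet> (\<Theta> *v v)"
    using pos_def_lower_bound[OF assms] by blast
  have "(norm (ext1 x))\<^sup>2 = 1 + (norm x)\<^sup>2" for x :: "real ^ 'n"
    by (simp add: power2_norm_eq_inner inner_vec_def ext1_def UNIV_option_conv sum.reindex)
  then have "c * (1 + (norm x)\<^sup>2) \<le> qf \<Theta> x" for x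
    using c(2)[of "ext1 x"] by (simp add: qf_def)
  then have *: "c * (norm x)\<^sup>2 \<le> qf \<Theta> x" for x
    using c(1) by (smt (verit) mult_left_mono)
  show ?thesis
  proof (rule boundedI)
    fix x assume "x \<in> {x. qf \<Theta> x \<le> b}"
    then have "c * (norm x)\<^sup>2 \<le> b"
      using *[of x] by simp
    then have "(norm x)\<^sup>2 \<le> b / c"
      using c(1) by (simp add: field_simps)
    then show "norm x \<le> sqrt (b / c)"
      by (rule real_le_rsqrt)
  qed
qed

lemma compact_qf_le:
  assumes "pos_def \<Theta>" "closed F"
  shows "compact {x \<in> F. qf \<Theta> x \<le> b}"
proof -
  have "closed (F \<inter> {x. qf \<Theta> x \<le> b})"
    by (intro closed_Int assms closed_Collect_le continuous_intros)
  then have "compact (F \<inter> {x. qf \<Theta> x \<le> b})"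
    using bounded_qf_le[OF assms(1), of b] by (simp add: compact_eq_bounded_closed bounded_Int)
  then show ?thesis
    by (simp add: Int_def)
qed

lemma qf_arg_min_exists:
  assumes "pos_def \<Theta>" "closed F" "F \<noteq> {}"
  shows "\<exists>u. is_arg_min (qf \<Theta>) (\<lambda>x. x \<in> F) u"
proof -
  obtain z where "z \<in> F"
    using assms(3) by blast
  let ?C = "{x \<in> F. qf \<Theta> x \<le> qf \<Theta> z}"
  have "z \<in> ?C"
    using \<open>z \<in> F\<close> by simp
  then obtain u where u: "u \<in> ?C" "\<forall>x\<in>?C. qf \<Theta> u \<le> qf \<Theta> x"
    using continuous_attains_inf[OF compact_qf_le[OF assms(1,2)] _ continuous_on_qf] by blast
  have "qf \<Theta> u \<le> qf \<Theta> x" if "x \<in> F" for x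
    using u that by (cases "qf \<Theta> x \<le> qf \<Theta> z") auto
  then show ?thesis
    using u(1) by (auto simp: is_arg_min_linorder)
qed

lemma closed_qf_ge: "closed F \<Longrightarrow> closed {x \<in> F. b \<le> qf \<Theta> x}"
  using closed_Int[OF _ closed_Collect_le[OF continuous_on_const continuous_on_qf], of F b \<Theta>]
  by (simp add: Int_def)

text \<open>By isolation, \<open>F - {xs}\<close> is \<open>F\<close> minus an open set, hence
  closed. If it is nonempty, the form attains a minimum there, and \<open>\<epsilon>\<close> is the
  excess of this minimum over the value at \<open>xs\<close>.\<close>

lemma qf_gap:
  assumes "pos_def \<Theta>" "closed F" "F \<subseteq> S" "xs isolated_in S"
    and "\<And>x. x \<in> F \<Longrightarrow> x \<noteq> xs \<Longrightarrow> qf \<Theta> xs < qf \<Theta> x"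
  obtains \<epsilon> where "\<epsilon> > 0" "\<And>x. x \<in> F \<Longrightarrow> x \<noteq> xs \<Longrightarrow> qf \<Theta> xs + \<epsilon> \<le> qf \<Theta> x"
proof -
  obtain T where T: "open T" "T \<inter> S = {xs}"
    using assms(4) by (auto simp: isolated_in_def)
  have "F - {xs} = F - T"
    using T(2) assms(3) by blast
  then have closed: "closed (F - {xs})"
    using closed_Diff[OF assms(2) T(1)] by simp
  show ?thesis
  proof (cases "F - {xs} = {}")
    case True
    then show ?thesis
      by (intro that[of 1]) auto
  next
    case False
    then obtain u where u: "is_arg_min (qf \<Theta>) (\<lambda>x. x \<in> F - {xs}) u"
      using qf_arg_min_exists[OF assms(1) closed] by blast
    then have "qf \<Theta> xs < qf \<Theta> u"
      using assms(5) by (auto simp: is_arg_min_def)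
    moreover have "qf \<Theta> u \<le> qf \<Theta> x" if "x \<in> F" "x \<noteq> xs" for x
      using u that by (simp add: is_arg_min_linorder)
    ultimately show ?thesis
      by (intro that[of "qf \<Theta> u - qf \<Theta> xs"]) auto
  qed
qed

section \<open>The algorithms\<close>

lemma L_opt_subset_feas: "L_opt P i u \<subseteq> feas P i"
  by (auto simp: L_opt_def is_arg_min_def)

lemma L_obj_arg_min:
  assumes "L_solvable P u"
  shows "arg_min (L_obj P i u) (\<lambda>v. v \<in> feas P i) \<in> L_opt P i u"
  using assms unfolding L_solvable_def L_opt_def arg_min_def by (auto intro: someI)

text \<open>All optimizers share one value, so the choice hidden in \<open>arg_min\<close> does not
  affect \<open>\<omega>\<close>.\<close>

lemma L_obj_L_opt:
  assumes "v \<in> L_opt P i u"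
  shows "L_obj P i u v = \<omega> P i u"
proof -
  have "arg_min (L_obj P i u) (\<lambda>v. v \<in> feas P i) \<in> L_opt P i u"
    using assms unfolding L_opt_def arg_min_def by (auto intro: someI)
  then show ?thesis
    using assms unfolding \<omega>_def L_opt_def
    by (intro antisym) (simp_all add: is_arg_min_linorder)
qed

lemma \<omega>_le: "L_solvable P u \<Longrightarrow> v \<in> feas P i \<Longrightarrow> \<omega> P i u \<le> L_obj P i u v"
  using L_obj_arg_min[of P u i] by (simp add: \<omega>_def L_opt_def is_arg_min_linorder)

lemma mem_NE_iff:
  "u \<in> NE P \<longleftrightarrow> (\<forall>i. strat P i u \<in> feas P i \<and> (\<forall>v\<in>feas P i. 0 \<le> L_obj P i u v))"
  by (auto simp: NE_def is_arg_min_linorder L_obj_def)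

text \<open>Correctness of the stopping test: KKT points are feasible, so only profitable deviations
  can prevent an equilibrium.\<close>

lemma NE_iff_\<omega>_nonneg:
  assumes "u \<in> KKT P H" "L_solvable P u"
  shows "u \<in> NE P \<longleftrightarrow> (\<forall>i. 0 \<le> \<omega> P i u)"
proof
  assume "u \<in> NE P"
  then show "\<forall>i. 0 \<le> \<omega> P i u"
    using subsetD[OF L_opt_subset_feas L_obj_arg_min[OF assms(2)]] by (simp add: \<omega>_def mem_NE_iff)
next
  assume "\<forall>i. 0 \<le> \<omega> P i u"
  then show "u \<in> NE P"
    using order_trans[OF _ \<omega>_le[OF assms(2)]] KKT_strat_feas[OF assms(1)] by (simp add: mem_NE_iff)
qed

text \<open>The cuts come from feasible deviations, none of which is profitable at an
  equilibrium.\<close>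

lemma NE_subset_U_feas:
  assumes "NE P \<subseteq> KKT P H" "\<And>i. K i \<subseteq> feas P i"
  shows "NE P \<subseteq> U_feas P H K"
  using assms by (force simp: U_feas_def mem_NE_iff L_obj_def)

lemma U_feas_subset_KKT: "U_feas P H K \<subseteq> KKT P H"
  by (auto simp: U_feas_def)

lemma U_feas_antimono: "(\<And>i. K i \<subseteq> K' i) \<Longrightarrow> U_feas P H K' \<subseteq> U_feas P H K"
  by (auto simp: U_feas_def)

lemma enlarge_cases:
  assumes "enlarge P u K K'"
  obtains (enlarged) V where "\<omega> P i u < 0" "V \<noteq> {}" "V \<subseteq> L_opt P i u" "K' i = K i \<union> V"
    | (unchanged) "\<not> \<omega> P i u < 0" "K' i = K i"
  using spec[OF assms[unfolded enlarge_def], of i] by (cases "\<omega> P i u < 0") auto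

lemma enlarge_lower: "enlarge P u K K' \<Longrightarrow> K i \<subseteq> K' i"
  by (erule enlarge_cases[of P u K K' i]) auto

lemma enlarge_upper: "enlarge P u K K' \<Longrightarrow> K' i \<subseteq> K i \<union> feas P i"
  using L_opt_subset_feas[of P i u] by (elim enlarge_cases[of P u K K' i]) blast+

lemma enlarge_exists:
  assumes "L_solvable P u"
  shows "\<exists>K'. enlarge P u K K'"
proof
  show "enlarge P u K (\<lambda>i. if \<omega> P i u < 0 then K i \<union> {SOME v. v \<in> L_opt P i u} else K i)"
    unfolding enlarge_def
  proof
    fix i
    have "(SOME v. v \<in> L_opt P i u) \<in> L_opt P i u"
      using assms by (simp add: L_solvable_def some_in_eq)
    then show "if \<omega> P i u < 0
       then \<exists>V. finite V \<and> V \<noteq> {} \<and> V \<subseteq> L_opt P i u \<and>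
         (if \<omega> P i u < 0 then K i \<union> {SOME v. v \<in> L_opt P i u} else K i) = K i \<union> V
       else (if \<omega> P i u < 0 then K i \<union> {SOME v. v \<in> L_opt P i u} else K i) = K i"
      by (auto intro!: exI[of _ "{SOME v. v \<in> L_opt P i u}"])
  qed
qed

text \<open>Each added optimizer \<open>v\<close> changes the objective of player \<open>i\<close>
  by \<open>\<omega> P i u < 0\<close>, so \<open>u\<close> violates the inequality that (U) now
  demands for \<open>v\<close>.\<close>

lemma enlarge_cuts_off:
  assumes "enlarge P u K K'" "\<omega> P i u < 0"
  shows "u \<notin> U_feas P H K'"
proof -
  obtain v where v: "v \<in> K' i" "v \<in> L_opt P i u"
    using assms(2) by (cases rule: enlarge_cases[OF assms(1), of i]) blast+
  then have "L_obj P i u v < 0"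
    using L_obj_L_opt assms(2) by metis
  with v(1) show ?thesis
    by (force simp: U_feas_def L_obj_def)
qed

text \<open>Optimality from Step 1 survives to the output because Step 2 changes neither the sets
  nor the point.\<close>

lemma computed_by_A_invariant:
  assumes "computed_by_A P H \<Theta> K xs"
  shows "\<forall>i. K i \<subseteq> feas P i" and "is_arg_min (qf \<Theta>) (\<lambda>x. x \<in> U_feas P H K) xs"
proof -
  define inv where "inv s = (case s of
      A1 K \<Rightarrow> \<forall>i. K i \<subseteq> feas P i
    | A2 K u \<Rightarrow> (\<forall>i. K i \<subseteq> feas P i) \<and> is_arg_min (qf \<Theta>) (\<lambda>x. x \<in> U_feas P H K) u
    | A3 K u \<Rightarrow> \<forall>i. K i \<subseteq> feas P i
    | A_found K u \<Rightarrow> (\<forall>i. K i \<subseteq> feas P i) \<and> is_arg_min (qf \<Theta>) (\<lambda>x. x \<in> U_feas P H K) u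
    | A_none \<Rightarrow> True)" for s
  have step: "inv s'" if "stepA P H \<Theta> s s'" "inv s" for s s'
    using that
  proof cases
    case (5 u K K')
    then show ?thesis
      using that(2) enlarge_upper[of P u K K'] by (simp add: inv_def) blast
  qed (use that(2) in \<open>simp_all add: inv_def\<close>)
  have "inv (A_found K xs)"
    using assms unfolding computed_by_A_def
  proof (induction rule: rtranclp_induct)
    case base
    show ?case by (simp add: inv_def)
  qed (rule step)
  then show "\<forall>i. K i \<subseteq> feas P i" and "is_arg_min (qf \<Theta>) (\<lambda>x. x \<in> U_feas P H K) xs"
    by (simp_all add: inv_def)
qed

section \<open>Termination and correctness of Algorithm B\<close>

text \<open>A run takes at most \<open>\<mu> s\<close> steps. Decrease is required only on reachable
  states, where invariants are available.\<close>

lemma terminates_withI: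
  fixes \<mu> :: "'s \<Rightarrow> nat"
  assumes decrease: "\<And>s' s''. step\<^sup>*\<^sup>* s s' \<Longrightarrow> step s' s'' \<Longrightarrow> \<mu> s'' < \<mu> s'"
    and final: "\<And>s'. step\<^sup>*\<^sup>* s s' \<Longrightarrow> \<nexists>s''. step s' s'' \<Longrightarrow> Q s'"
  shows "terminates_with step s Q"
  unfolding terminates_with_def
proof (intro conjI allI impI notI)
  assume "\<exists>\<sigma>. \<sigma> 0 = s \<and> (\<forall>t. step (\<sigma> t) (\<sigma> (Suc t)))"
  then obtain \<sigma> :: "nat \<Rightarrow> 's" where \<sigma>: "\<sigma> 0 = s" "\<And>t. step (\<sigma> t) (\<sigma> (Suc t))"
    by blast
  have reach: "step\<^sup>*\<^sup>* s (\<sigma> t)" for t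
    by (induction t) (use \<sigma> in \<open>auto intro: rtranclp.rtrancl_into_rtrancl\<close>)
  have "\<mu> (\<sigma> t) + t \<le> \<mu> (\<sigma> 0)" for t
  proof (induction t)
    case (Suc t)
    then show ?case
      using decrease[OF reach \<sigma>(2), of t] by linarith
  qed simp
  from this[of "Suc (\<mu> (\<sigma> 0))"] show False by simp
qed (use final in blast)

text \<open>Used with \<open>z = \<delta>' / \<epsilon>\<close> to count reductions of \<delta>. It
  holds since \<open>z < \<lfloor>z\<rfloor> + 1 \<le> 2 * \<lfloor>z\<rfloor>\<close>.\<close>

lemma floor_div_5_less:
  fixes z :: real
  assumes "1 \<le> z"
  shows "nat \<lfloor>z / 5\<rfloor> < nat \<lfloor>z\<rfloor>"
proof -
  have "1 \<le> \<lfloor>z\<rfloor>"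
    using assms by simp
  moreover from this have "z / 5 < of_int \<lfloor>z\<rfloor>"
    using floor_correct[of z] by (simp, linarith)
  ultimately show ?thesis
    by (simp add: floor_less_iff zless_nat_conj)
qed

text \<open>The deterministic core: genericity enters only through \<open>strict\<close>. An
  invariant makes the outputs correct, a measure excludes infinite runs, and existence of optimizers
  keeps runs from getting stuck.\<close>

lemma algorithm_B_terminates:
  fixes P :: "('p::finite, 'n::finite, 'j::finite) nep"
  assumes NE_KKT: "NE P \<subseteq> KKT P H" and fin: "finite (KKT P H - NE P)"
    and pd: "pos_def \<Theta>" and K: "\<And>i. K i \<subseteq> feas P i"
    and xs: "xs \<in> U_feas P H K"
    and strict: "\<And>x. x \<in> U_feas P H K \<Longrightarrow> x \<noteq> xs \<Longrightarrow> qf \<Theta> xs < qf \<Theta> x"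
    and isolated: "xs isolated_in KKT P H" and \<delta>: "\<delta> > 0"
    and solvable: "\<And>\<delta>' K' u. (stepB P H \<Theta> xs)\<^sup>*\<^sup>* (B1 \<delta> K) (B3 \<delta>' K' u) \<Longrightarrow> L_solvable P u"
  shows "terminates_with (stepB P H \<Theta> xs) (B1 \<delta> K)
      (\<lambda>s. (\<exists>u. s = B_found u \<and> u \<in> NE P \<and> u \<noteq> xs) \<or> (s = B_none \<and> (\<forall>y\<in>NE P. y = xs)))"
proof -
  obtain \<epsilon> where \<epsilon>: "\<epsilon> > 0" "\<And>x. x \<in> U_feas P H K \<Longrightarrow> x \<noteq> xs \<Longrightarrow> qf \<Theta> xs + \<epsilon> \<le> qf \<Theta> x"
    using qf_gap[OF pd closed_U_feas U_feas_subset_KKT isolated strict] by blast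
  \<comment> \<open>The second condition concerns the initial sets \<open>K\<close>; it persists
    under cuts because these only shrink the feasible set.\<close>
  define good where "good \<delta>' K' \<longleftrightarrow> \<delta>' > 0 \<and>
      (\<forall>x\<in>U_feas P H K. x \<noteq> xs \<longrightarrow> qf \<Theta> xs + \<delta>' < qf \<Theta> x) \<and>
      (\<forall>i. K i \<subseteq> K' i \<and> K' i \<subseteq> feas P i)" for \<delta>' K'
  define inv where "inv s = (case s of
      B1 \<delta>' K' \<Rightarrow> K' = K \<and> \<delta>' > 0
    | B2 \<delta>' K' \<Rightarrow> good \<delta>' K'
    | B3 \<delta>' K' u \<Rightarrow> good \<delta>' K' \<and> u \<in> U\<delta>_feas P H \<Theta> K' xs \<delta>'
    | B4 \<delta>' K' u \<Rightarrow> good \<delta>' K' \<and> u \<in> U\<delta>_feas P H \<Theta> K' xs \<delta>' \<and> L_solvable P u \<and> (\<exists>i. \<omega> P i u < 0)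
    | B_found u \<Rightarrow> u \<in> NE P \<and> u \<noteq> xs
    | B_none \<Rightarrow> \<forall>y\<in>NE P. y = xs)" for s
  define bad where "bad K' = U_feas P H K' \<inter> (KKT P H - NE P)" for K'
  \<comment> \<open>A round through \<open>B2\<close>, \<open>B3\<close>, \<open>B4\<close> takes
    three steps and removes an element of \<open>bad K'\<close>, hence the factor 3. The offset 3
    puts \<open>B1\<close> above \<open>B2\<close>, and the floor bounds the number of reductions of
    \<delta>.\<close>
  define \<mu> where "\<mu> s = (case s of
      B1 \<delta>' K' \<Rightarrow> 3 * card (KKT P H - NE P) + 3 + nat \<lfloor>\<delta>' / \<epsilon>\<rfloor>
    | B2 \<delta>' K' \<Rightarrow> 3 * card (bad K') + 2
    | B3 \<delta>' K' u \<Rightarrow> 3 * card (bad K') + 1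
    | B4 \<delta>' K' u \<Rightarrow> 3 * card (bad K')
    | B_found u \<Rightarrow> 0
    | B_none \<Rightarrow> 0)" for s :: "('p, 'n) stateB"
  have NE_U: "NE P \<subseteq> U_feas P H K"
    using NE_subset_U_feas[OF NE_KKT K] .
  have inv_step: "inv s'" if s: "stepB P H \<Theta> xs s s'" "inv s" for s s'
    using s(1)
  proof cases
    case (1 K' \<delta>' y)
    \<comment> \<open>Otherwise \<open>x\<close> would be feasible for the maximization, whose
      optimal value is that of \<open>xs\<close>, contrary to \<open>strict\<close>.\<close>
    have "qf \<Theta> xs + \<delta>' < qf \<Theta> x" if x: "x \<in> U_feas P H K" "x \<noteq> xs" for x
    proof (rule ccontr)
      assume "\<not> qf \<Theta> xs + \<delta>' < qf \<Theta> x"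
      then have "qf \<Theta> x \<le> qf \<Theta> y"
        using 1 s(2) x by (simp add: inv_def M\<delta>_feas_def is_arg_max_linorder)
      then show False
        using strict[OF x] 1 by simp
    qed
    then show ?thesis
      using 1 s(2) K by (simp add: inv_def good_def)
  next
    case (2 K' \<delta>' y)
    then show ?thesis
      using s(2) by (simp add: inv_def)
  next
    case (3 K' \<delta>')
    \<comment> \<open>Equilibria survive all cuts, and by \<open>good\<close> those other than
      \<open>xs\<close> have values beyond the threshold.\<close>
    have "y = xs" if "y \<in> NE P" for y
    proof (rule ccontr)
      assume "y \<noteq> xs"
      have good: "good \<delta>' K'"
        using 3 s(2) by (simp add: inv_def)
      then have "y \<in> U_feas P H K'"
        using NE_subset_U_feas[OF NE_KKT, of K'] that by (auto simp: good_def)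
      then have "y \<in> U\<delta>_feas P H \<Theta> K' xs \<delta>'"
        using good that NE_U \<open>y \<noteq> xs\<close> by (auto simp: good_def U\<delta>_feas_def intro: less_imp_le)
      then show False
        using 3 by simp
    qed
    then show ?thesis
      using 3 by (simp add: inv_def)
  next
    case (4 K' \<delta>' u)
    then show ?thesis
      using s(2) by (simp add: inv_def is_arg_min_def)
  next
    case (5 u \<delta>' K')
    then have u: "u \<in> U_feas P H K'" "qf \<Theta> xs + \<delta>' \<le> qf \<Theta> u" "\<delta>' > 0"
      using s(2) by (simp_all add: inv_def good_def U\<delta>_feas_def)
    then have "u \<in> NE P"
      using 5 NE_iff_\<omega>_nonneg[of u P H] U_feas_subset_KKT by blast
    then show ?thesis
      using 5 u by (auto simp: inv_def)
  next
    case (6 u \<delta>' K')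
    then show ?thesis
      using s(2) by (simp add: inv_def)
  next
    case (7 u K' K'' \<delta>')
    then have "good \<delta>' K'"
      using s(2) by (simp add: inv_def)
    then have "good \<delta>' K''"
      using enlarge_lower[OF 7(3)] enlarge_upper[OF 7(3)] unfolding good_def by blast
    then show ?thesis
      using 7 by (simp add: inv_def)
  qed
  have inv: "inv s" if "(stepB P H \<Theta> xs)\<^sup>*\<^sup>* (B1 \<delta> K) s" for s
    using that
  proof (induction rule: rtranclp_induct)
    case base
    show ?case by (simp add: inv_def \<delta>)
  qed (rule inv_step)
  show ?thesis
  proof (rule terminates_withI[where \<mu>=\<mu>])
    fix s s'
    assume "(stepB P H \<Theta> xs)\<^sup>*\<^sup>* (B1 \<delta> K) s" and "stepB P H \<Theta> xs s s'"
    note s = inv[OF this(1)] this(2)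
    from s(2) show "\<mu> s' < \<mu> s"
    proof cases
      case (1 K' \<delta>' y)
      have "card (bad K') \<le> card (KKT P H - NE P)"
        by (intro card_mono fin) (auto simp: bad_def)
      then show ?thesis
        using 1 by (simp add: \<mu>_def)
    next
      case (2 K' \<delta>' y)
      then have "y \<in> U_feas P H K" "qf \<Theta> y \<le> qf \<Theta> xs + \<delta>'"
        using s(1) by (simp_all add: inv_def M\<delta>_feas_def is_arg_max_def)
      moreover have "y \<noteq> xs"
        using 2 by auto
      \<comment> \<open>A rejected \<open>\<delta>'\<close> reaches a feasible point other than
        \<open>xs\<close>, so it is at least the gap; this bounds the number of rejections.\<close>
      ultimately have "\<epsilon> \<le> \<delta>'"
        using \<epsilon>(2)[of y] by linarith
      then have "nat \<lfloor>\<delta>' / \<epsilon> / 5\<rfloor> < nat \<lfloor>\<delta>' / \<epsilon>\<rfloor>"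
        using \<epsilon>(1) by (intro floor_div_5_less) simp
      then show ?thesis
        using 2 by (simp add: \<mu>_def mult.commute)
    next
      case (7 u K' K'' \<delta>')
      then have u: "u \<in> U_feas P H K'" "L_solvable P u"
        using s(1) by (simp_all add: inv_def U\<delta>_feas_def)
      obtain i where i: "\<omega> P i u < 0"
        using 7 s(1) by (auto simp: inv_def)
      have "u \<in> KKT P H"
        using u(1) U_feas_subset_KKT by blast
      moreover from this have "u \<notin> NE P"
        using i NE_iff_\<omega>_nonneg[OF _ u(2)] not_le by blast
      ultimately have "u \<in> bad K'"
        using u(1) by (simp add: bad_def)
      moreover have "u \<notin> bad K''"
        using enlarge_cuts_off[OF 7(3) i] by (simp add: bad_def)
      moreover have "bad K'' \<subseteq> bad K'"
        using U_feas_antimono[of K' K'' P H] enlarge_lower[OF 7(3)] unfolding bad_def by blast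
      moreover have "finite (bad K')"
        unfolding bad_def using fin by simp
      ultimately have "card (bad K'') < card (bad K')"
        by (intro psubset_card_mono) auto
      then show ?thesis
        using 7 by (simp add: \<mu>_def)
    qed (simp_all add: \<mu>_def)
  next
    fix s
    assume reach: "(stepB P H \<Theta> xs)\<^sup>*\<^sup>* (B1 \<delta> K) s" and stuck: "\<nexists>s'. stepB P H \<Theta> xs s s'"
    note inv = inv[OF reach]
    show "(\<exists>u. s = B_found u \<and> u \<in> NE P \<and> u \<noteq> xs) \<or> (s = B_none \<and> (\<forall>y\<in>NE P. y = xs))"
    proof (cases s)
      case (B1 \<delta>' K')
      then have K': "K' = K" "\<delta>' > 0"
        using inv by (simp_all add: inv_def)
      have xs_M: "xs \<in> M\<delta>_feas P H \<Theta> K xs \<delta>'"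
        using xs K' by (simp add: M\<delta>_feas_def)
      \<comment> \<open>A maximizer exists by compactness, and its value is at least that of the
        feasible point \<open>xs\<close>, so one of the two transitions from \<open>B1\<close>
        applies.\<close>
      have "compact (M\<delta>_feas P H \<Theta> K xs \<delta>')"
        unfolding M\<delta>_feas_def by (intro compact_qf_le pd closed_U_feas)
      then obtain y where "y \<in> M\<delta>_feas P H \<Theta> K xs \<delta>'" "\<forall>x\<in>M\<delta>_feas P H \<Theta> K xs \<delta>'. qf \<Theta> x \<le> qf \<Theta> y"
        using continuous_attains_sup[OF _ _ continuous_on_qf] xs_M by blast
      then have y: "is_arg_max (qf \<Theta>) (\<lambda>x. x \<in> M\<delta>_feas P H \<Theta> K xs \<delta>') y" "qf \<Theta> xs \<le> qf \<Theta> y"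
        using xs_M by (simp_all add: is_arg_max_linorder)
      have "\<exists>s'. stepB P H \<Theta> xs s s'"
      proof (cases "qf \<Theta> y = qf \<Theta> xs")
        case True
        then show ?thesis
          using stepB.intros(1)[OF y(1)] B1 K' by blast
      next
        case False
        then show ?thesis
          using stepB.intros(2)[OF y(1)] y(2) B1 K' by fastforce
      qed
      then show ?thesis
        using stuck by blast
    next
      case (B2 \<delta>' K')
      have "closed (U\<delta>_feas P H \<Theta> K' xs \<delta>')"
        unfolding U\<delta>_feas_def by (intro closed_qf_ge closed_U_feas)
      then obtain u where "is_arg_min (qf \<Theta>) (\<lambda>x. x \<in> U\<delta>_feas P H \<Theta> K' xs \<delta>') u \<or>
          U\<delta>_feas P H \<Theta> K' xs \<delta>' = {}"
        using qf_arg_min_exists[OF pd] by blast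
      then have "\<exists>s'. stepB P H \<Theta> xs s s'"
        unfolding B2 using stepB.intros(3) stepB.intros(4) by blast
      then show ?thesis
        using stuck by blast
    next
      case (B3 \<delta>' K' u)
      then have solv: "L_solvable P u"
        using solvable reach by blast
      have "(\<forall>i. 0 \<le> \<omega> P i u) \<or> (\<exists>i. \<omega> P i u < 0)"
        by (meson not_le)
      then have "\<exists>s'. stepB P H \<Theta> xs s s'"
        unfolding B3 using stepB.intros(5)[OF solv] stepB.intros(6)[OF solv] by blast
      then show ?thesis
        using stuck by blast
    next
      case (B4 \<delta>' K' u)
      then have "L_solvable P u"
        using inv by (simp add: inv_def)
      then obtain K'' where "enlarge P u K' K''"
        using enlarge_exists by blast
      then show ?thesis
        using stuck B4 stepB.intros(7) by blast
    qed (use inv in \<open>simp_all add: inv_def\<close>)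
  qed
qed

theorem theorem3p8:
  fixes P :: "('p::finite, 'n::finite, 'j::finite) nep"
    and H :: "'p \<Rightarrow> ('n mpoly) ^ ('n + 'j) ^ 'j"
  assumes "nep P"
    and "\<And>i. nonsingular P i"
    and "\<And>i. left_inverse P i (H i)"
    and "finite (KKT P H - NE P)"
  shows "generic_pos_def (\<lambda>\<Theta>. \<forall>xs K \<delta>.
    computed_by_A P H \<Theta> K xs \<and>
    xs isolated_in KKT P H \<and>
    \<delta> > 0 \<and>
    (\<forall>\<delta>' K' u. (stepB P H \<Theta> xs)\<^sup>*\<^sup>* (B1 \<delta> K) (B3 \<delta>' K' u) \<longrightarrow> L_solvable P u) \<longrightarrow>
    terminates_with (stepB P H \<Theta> xs) (B1 \<delta> K)
      (\<lambda>s. (\<exists>u. s = B_found u \<and> u \<in> NE P \<and> u \<noteq> xs) \<or>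
           (s = B_none \<and> (\<forall>y\<in>NE P. y = xs))))"
proof -
  have NE_KKT: "NE P \<subseteq> KKT P H"
    using NE_subset_KKT assms(1,3) by blast
  \<comment> \<open>The sets \<open>K i\<close> may vary over infinitely many possibilities, but the
    feasible sets of (U) all lie in this finite family, so one null set of matrices serves every run
    of Algorithm A.\<close>
  let ?\<F> = "(\<lambda>S. NE P \<union> S) ` Pow (KKT P H - NE P)"
  have U_feas: "U_feas P H K \<in> ?\<F>" if "\<forall>i. K i \<subseteq> feas P i" for K
    using NE_subset_U_feas[OF NE_KKT, of K] U_feas_subset_KKT[of P H K] that
    by (intro image_eqI[of _ _ "U_feas P H K - NE P"]) auto
  have "AE \<theta> in sym_measure. \<forall>F\<in>?\<F>. \<forall>x y. is_arg_min (qf (sym_matrix \<theta>)) (\<lambda>x. x \<in> F) x \<and>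
      is_arg_min (qf (sym_matrix \<theta>)) (\<lambda>x. x \<in> F) y \<longrightarrow> x = y"
    using assms(4)
    by (intro AE_ball_countable[THEN iffD2] ballI AE_unique_minimizer countable_finite) simp
  then show ?thesis
    unfolding generic_pos_def_def
  proof eventually_elim
    case (elim \<theta>)
    let ?\<Theta> = "sym_matrix \<theta>"
    show ?case
    proof (intro impI allI, elim conjE)
      fix xs K \<delta>
      assume pd: "pos_def ?\<Theta>" and A: "computed_by_A P H ?\<Theta> K xs"
        and rest: "xs isolated_in KKT P H" "\<delta> > 0"
          "\<forall>\<delta>' K' u. (stepB P H ?\<Theta> xs)\<^sup>*\<^sup>* (B1 \<delta> K) (B3 \<delta>' K' u) \<longrightarrow> L_solvable P u"
      note A = computed_by_A_invariant[OF A]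
      \<comment> \<open>A point of no larger value would be a second minimizer over the same member
        of \<open>?\<F>\<close>.\<close>
      have "qf ?\<Theta> xs < qf ?\<Theta> x" if x: "x \<in> U_feas P H K" "x \<noteq> xs" for x
      proof (rule ccontr)
        assume "\<not> qf ?\<Theta> xs < qf ?\<Theta> x"
        then have "is_arg_min (qf ?\<Theta>) (\<lambda>x. x \<in> U_feas P H K) x"
          using A(2) x(1) by (force simp: is_arg_min_linorder)
        then show False
          using elim U_feas[OF A(1)] A(2) x(2) by blast
      qed
      moreover have "xs \<in> U_feas P H K"
        using A(2) by (simp add: is_arg_min_def)
      ultimately show "terminates_with (stepB P H ?\<Theta> xs) (B1 \<delta> K)
          (\<lambda>s. (\<exists>u. s = B_found u \<and> u \<in> NE P \<and> u \<noteq> xs) \<or> (s = B_none \<and> (\<forall>y\<in>NE P. y = xs)))"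
        using A(1) rest by (intro algorithm_B_terminates[OF NE_KKT assms(4) pd]) blast+
    qed
  qed
qed

end
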